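(* Let $r$ be a fixed positive integer. For every $\varepsilon>0$ there exist constants $C=C(r,\varepsilon)>0$ and $p_0=p_0(r,\varepsilon)$ such that the following holds for every prime $p\ge p_0$. Let $\mathcal{M}\subseteq\mathbb{F}_p$ be an arbitrary set of cardinality $M$ with $1\le M\le p^{1/2}$ and let $\mathcal{K}\subseteq\mathbb{F}_p^*$ be an interval of length $K\ge p^{1/r}$. Then for all $a\in\mathbb{F}_p^*$ and arbitrary complex weights $\boldsymbol\alpha=\{\alpha_m\}_{m\in\mathcal{M}}$, $\boldsymbol\gamma=\{\gamma_k\}_{k\in\mathcal{K}}$, $$\Bigl|\sum_{m\in\mathcal{M}}\sum_{k\in\mathcal{K}}\alpha_m\gamma_k\,\mathbf{e}_p(amk^{-1})\Bigr|\le C\,\|\boldsymbol\alpha\|_\infty\|\boldsymbol\gamma\|_\infty\,MK\,p^{\varepsilon}\Bigl(\frac1{M^{2r}}+\frac1K+\frac{p^{1+1/r}}{M^{10/13}K^2}\Bigr)^{1/(4r)}.$$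
   Context: $\mathbf{e}_p(z)=\exp(2\pi i z/p)$; $k^{-1}$ is the inverse of $k$ in $\mathbb{F}_p^*$. $\mathbb{F}_p$ is identified with $\{0,1,\dots,p-1\}$; an interval in $\mathbb{F}_p$ of length $K$ is the set of residues modulo $p$ of $K$ consecutive integers $K_0+1,\dots,K_0+K$. $\|\boldsymbol\alpha\|_\infty=\max_m|\alpha_m|$ and similarly for $\boldsymbol\gamma$. The paper's notation $f\ll p^{o(1)}g$ means: for every $\varepsilon>0$ there is a constant $C_\varepsilon$ with $|f|\le C_\varepsilon p^\varepsilon g$ for all sufficiently large $p$; this has been written out in the claim. *)

theory Defs
  imports "HOL-Analysis.Analysis" "HOL-Number_Theory.Number_Theory"
begin

text \<open>
  The field with \<open>p\<close> elements is represented by its least non-negative residues, as integers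
  reduced modulo \<open>p\<close>. The inverse of a unit is the library's \<^const>\<open>modular_inverse\<close>.
\<close>

definition Fp :: "nat \<Rightarrow> int set" where
  "Fp p = {0..<int p}"

definition Fp_units :: "nat \<Rightarrow> int set" where
  "Fp_units p = Fp p - {0}"

definition e_mod :: "nat \<Rightarrow> int \<Rightarrow> complex" where
  "e_mod p z = exp (2 * of_real pi * \<i> * of_int z / of_nat p)"

text \<open>
  The integers \<open>K0 + 1, \<dots>, K0 + K\<close> may wrap around modulo \<open>p\<close>. If the interval
  is contained in the units then \<open>K < p\<close>, so \<open>K\<close> is also its cardinality.
\<close>

definition Fp_interval :: "nat \<Rightarrow> nat \<Rightarrow> int set \<Rightarrow> bool" where
  "Fp_interval p K S \<longleftrightarrow> (\<exists>K0::int. S = (\<lambda>x. x mod int p) ` {K0 + 1..K0 + int K})"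

text \<open>Only meaningful for finite non-empty index sets, since \<^const>\<open>Max\<close> is unspecified otherwise.\<close>

definition weight_norm :: "int set \<Rightarrow> (int \<Rightarrow> complex) \<Rightarrow> real" where
  "weight_norm S f = (MAX x\<in>S. cmod (f x))"

end

(*
  By Cauchy-Schwarz over k, the weights gamma disappear and it suffices to bound the mean square
  over k in the interval of the sum over m of alpha_m e_p(a m / k). This is a sum of non-negative
  terms, so the interval may be replaced by any majorant, and no completion of incomplete sums
  is needed. Two majorants are used.

  (A) Replace k by k + u v with v up to V about p^(1/r) and u up to U about K / V. With
  x = a (m - n) / u and y = k / u the inner sum over v depends only on (x, y). Hoelder's inequality
  separates its 2r-th moment over all (x, y), which counts roots of a rational function, from the
  number of quadruples with (m - n) / u = (m' - n') / u' and k / u = k' / u'. Each common ratio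
  u / u' is a fraction a / b with coprime a, b up to U, and counting the points of the corresponding
  lattice in the boxes for (u, u') and (k, k') bounds this number, up to logarithms, by
  U K (M^3 + M^4 K^2 / p^2). Relative to M^2 K the 2r-th power of the off-diagonal part is then at
  most p^(1 + 1/r) / (M K^2) + p^(1/r - 1), which suffices if K^2 M^(10/13) <= p^2.

  (B) For longer intervals a Fejer type majorant and the elementary fourth moment
  of Kloosterman sums, sum over d of |S(d, h)|^4 <= 6 p^3, bound the off-diagonal part by
  M^(7/4) p^(3/4) up to a constant. The exponent 10/13 enters only through this case distinction.
*)
theory Submission
  imports Defs
begin

section \<open>Power means, additive characters and inverses modulo a prime\<close>

text \<open>Nothing is known about \<M>, so for a given ratio \<mu> = u / u' only trivial counts are
  available: at most M^3 quadruples satisfy m - n = \<mu> (m' - n'), and at most M^4 do so as \<mu>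
  varies. The lattice count is split accordingly. Its part 1 / (a b) depends on the fraction and is
  summed over a and b against M^3, giving the square of a harmonic number; its uniform part K^2 /
  p^2 is summed against M^4. The harmonic number is the only source of p^\<epsilon>.

  The length V about p^(1/r) is where the two parts V^r p and V^(2r) of the moment balance. The
  diagonal m = n has relative size 1 / M, the 2r-th root of the target's first summand 1 / M^(2r).
  In (A) the summand p^(1/r - 1) exceeds p^(1 + 1/r) / (M^(10/13) K^2) exactly when K^2 M^(10/13) >
  p^2, and there (B) takes over: the third summand of the target suffices for r = 2 and the second,
  1 / K, for r >= 3. For r = 1 there is no interval of units of length at least p.\<close>

text \<open>Jensen's inequality for powers in a division-free form, so that a total weight of zero
  is no special case. The induction step is Chebyshev's sum inequality: \<open>f\<close> and
  \<open>f ^ Suc n\<close> are ordered alike, so the double sum over products of their differences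
  is non-negative.\<close>

lemma weighted_power_mean:
  fixes w f :: "'a \<Rightarrow> real"
  assumes "\<And>i. i \<in> A \<Longrightarrow> w i \<ge> 0" "\<And>i. i \<in> A \<Longrightarrow> f i \<ge> 0"
  shows "(\<Sum>i\<in>A. w i * f i) ^ Suc n \<le> (\<Sum>i\<in>A. w i) ^ n * (\<Sum>i\<in>A. w i * f i ^ Suc n)"
proof (induction n)
  case 0
  show ?case by simp
next
  case (Suc n)
  let ?W = "\<Sum>i\<in>A. w i" and ?S = "\<lambda>k. \<Sum>i\<in>A. w i * f i ^ k"
  have mono: "(x ^ Suc n - y ^ Suc n) * (x - y) \<ge> 0" if "x \<ge> 0" "y \<ge> 0" for x y :: real
    using that power_mono[of x y "Suc n"] power_mono[of y x "Suc n"]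
    by (cases "x \<le> y") (auto simp: zero_le_mult_iff)
  have "0 \<le> (\<Sum>i\<in>A. \<Sum>j\<in>A. w i * w j * ((f i ^ Suc n - f j ^ Suc n) * (f i - f j)))"
    by (intro sum_nonneg mult_nonneg_nonneg[OF mult_nonneg_nonneg mono] assms)
  also have "\<dots> = (\<Sum>i\<in>A. \<Sum>j\<in>A. (w i * f i ^ Suc (Suc n)) * w j - (w i * f i ^ Suc n) * (w j * f j)
      - (w i * f i) * (w j * f j ^ Suc n) + w i * (w j * f j ^ Suc (Suc n)))"
    by (intro sum.cong refl) (simp add: algebra_simps)
  also have "\<dots> = 2 * (?W * ?S (Suc (Suc n)) - ?S (Suc n) * (\<Sum>i\<in>A. w i * f i))"
    by (simp add: sum.distrib sum_subtractf sum_product[symmetric] del: power_Suc)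
  finally have cheb: "?S (Suc n) * (\<Sum>i\<in>A. w i * f i) \<le> ?W * ?S (Suc (Suc n))" by simp
  have "(\<Sum>i\<in>A. w i * f i) ^ Suc (Suc n) \<le> (?W ^ n * ?S (Suc n)) * (\<Sum>i\<in>A. w i * f i)"
    unfolding power_Suc2[of _ "Suc n"] using assms by (intro mult_right_mono Suc sum_nonneg) auto
  also have "\<dots> \<le> ?W ^ n * (?W * ?S (Suc (Suc n)))"
    unfolding mult.assoc using assms by (intro mult_left_mono cheb zero_le_power sum_nonneg) auto
  finally show ?case by (simp only: power_Suc2 mult.assoc)
qed

lemma power_mean_card:
  fixes f :: "'a \<Rightarrow> real"
  assumes "\<And>i. i \<in> A \<Longrightarrow> f i \<ge> 0"
  shows "(\<Sum>i\<in>A. f i) ^ Suc n \<le> real (card A) ^ n * (\<Sum>i\<in>A. f i ^ Suc n)"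
  using weighted_power_mean[of A "\<lambda>_. 1" f n] assms by simp

text \<open>The power mean with weights \<nu> moves the exponent onto \<open>G\<close>;
  Cauchy-Schwarz then separates \<nu> from \<open>G\<close>. When \<nu> gives the fibre sizes of a
  map, the first two factors count points and pairs of points with equal image.\<close>

lemma holder_energy:
  fixes \<nu> G :: "'a \<Rightarrow> real"
  assumes "\<And>z. z \<in> Z \<Longrightarrow> \<nu> z \<ge> 0" "\<And>z. z \<in> Z \<Longrightarrow> G z \<ge> 0"
  shows "(\<Sum>z\<in>Z. \<nu> z * G z) ^ (2 * Suc n)
    \<le> (\<Sum>z\<in>Z. \<nu> z) ^ (2 * n) * (\<Sum>z\<in>Z. (\<nu> z)\<^sup>2) * (\<Sum>z\<in>Z. G z ^ (2 * Suc n))"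
proof -
  have "(\<Sum>z\<in>Z. \<nu> z * G z) ^ (2 * Suc n) = ((\<Sum>z\<in>Z. \<nu> z * G z) ^ Suc n)\<^sup>2"
    by (simp only: power_mult mult.commute[of 2])
  also have "\<dots> \<le> ((\<Sum>z\<in>Z. \<nu> z) ^ n * (\<Sum>z\<in>Z. \<nu> z * G z ^ Suc n))\<^sup>2"
    using assms by (intro power_mono weighted_power_mean zero_le_power sum_nonneg) auto
  also have "\<dots> = (\<Sum>z\<in>Z. \<nu> z) ^ (2 * n) * (\<Sum>z\<in>Z. \<nu> z * G z ^ Suc n)\<^sup>2"
    by (simp only: power_mult_distrib power_mult mult.commute[of 2])
  also have "\<dots> \<le> (\<Sum>z\<in>Z. \<nu> z) ^ (2 * n) * ((\<Sum>z\<in>Z. (\<nu> z)\<^sup>2) * (\<Sum>z\<in>Z. (G z ^ Suc n)\<^sup>2))"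
    using assms by (intro mult_left_mono Cauchy_Schwarz_ineq_sum zero_le_power sum_nonneg) auto
  finally show ?thesis
    by (simp only: power_mult mult.commute[of 2] mult.assoc)
qed

lemma sum_comp_fibres:
  fixes G :: "'b \<Rightarrow> real"
  assumes "finite \<Omega>" "finite Z" "f ` \<Omega> \<subseteq> Z"
  shows "(\<Sum>\<omega>\<in>\<Omega>. G (f \<omega>)) = (\<Sum>z\<in>Z. real (card {\<omega>\<in>\<Omega>. f \<omega> = z}) * G z)"
  using sum.group[OF assms, of "\<lambda>\<omega>. G (f \<omega>)"] by simp

lemma sum_card_fibres_squared:
  assumes "finite \<Omega>" "finite Z" "f ` \<Omega> \<subseteq> Z"
  shows "(\<Sum>z\<in>Z. (real (card {\<omega>\<in>\<Omega>. f \<omega> = z}))\<^sup>2)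
    = real (card {(\<omega>, \<omega>'). \<omega> \<in> \<Omega> \<and> \<omega>' \<in> \<Omega> \<and> f \<omega> = f \<omega>'})"
proof -
  have "{(\<omega>, \<omega>'). \<omega> \<in> \<Omega> \<and> \<omega>' \<in> \<Omega> \<and> f \<omega> = f \<omega>'} = (SIGMA \<omega>:\<Omega>. {\<omega>'\<in>\<Omega>. f \<omega>' = f \<omega>})"
    by auto
  hence "real (card {(\<omega>, \<omega>'). \<omega> \<in> \<Omega> \<and> \<omega>' \<in> \<Omega> \<and> f \<omega> = f \<omega>'})
      = (\<Sum>\<omega>\<in>\<Omega>. real (card {\<omega>'\<in>\<Omega>. f \<omega>' = f \<omega>}))"
    using assms(1) by simp
  also have "\<dots> = (\<Sum>z\<in>Z. (real (card {\<omega>\<in>\<Omega>. f \<omega> = z}))\<^sup>2)"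
    using sum_comp_fibres[OF assms, of "\<lambda>z. real (card {\<omega>'\<in>\<Omega>. f \<omega>' = z})"]
    by (simp add: power2_eq_square)
  finally show ?thesis by simp
qed

section \<open>Additive characters modulo p\<close>

lemma finite_Fp [simp]: "finite (Fp p)"
  by (simp add: Fp_def)

lemma card_Fp [simp]: "card (Fp p) = p"
  by (simp add: Fp_def)

lemma e_mod_cis: "e_mod p z = cis (2 * pi * of_int z / of_nat p)"
  by (simp add: e_mod_def cis_conv_exp mult_ac)

lemma norm_e_mod [simp]: "cmod (e_mod p z) = 1"
  by (simp add: e_mod_cis)

lemma e_mod_0 [simp]: "e_mod p 0 = 1"
  by (simp add: e_mod_cis)

lemma cnj_e_mod: "cnj (e_mod p z) = e_mod p (- z)"
  by (simp add: e_mod_cis cis_cnj)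

lemma e_mod_add: "e_mod p (x + y) = e_mod p x * e_mod p y"
  by (simp add: e_mod_cis cis_mult add_divide_distrib ring_distribs)

lemma e_mod_sum: "e_mod p (\<Sum>i\<in>A. f i) = (\<Prod>i\<in>A. e_mod p (f i))"
  by (induction A rule: infinite_finite_induct) (simp_all add: e_mod_add)

lemma e_mod_of_nat_mult: "e_mod p (int n * z) = e_mod p z ^ n"
  by (simp add: e_mod_cis Complex.DeMoivre mult_ac)

lemma e_mod_eq_1_iff:
  assumes "p > 0"
  shows "e_mod p z = 1 \<longleftrightarrow> int p dvd z"
proof -
  have "e_mod p z = 1 \<longleftrightarrow> cos (2 * pi * of_int z / of_nat p) = 1"
    by (auto simp: e_mod_cis complex_eq_iff cos_one_sin_zero)
  also have "\<dots> \<longleftrightarrow> (\<exists>n::int. 2 * pi * of_int z / of_nat p = 2 * pi * n)"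
    unfolding cos_one_2pi_int by (simp add: mult_ac)
  also have "\<dots> \<longleftrightarrow> (\<exists>n::int. z = int p * n)"
  proof (intro ex_cong1)
    fix n :: int
    have "2 * pi * of_int z / of_nat p = 2 * pi * n \<longleftrightarrow> (of_int z :: real) = of_int (int p * n)"
      using assms by (simp add: field_simps)
    thus "2 * pi * of_int z / of_nat p = 2 * pi * n \<longleftrightarrow> z = int p * n"
      by (simp only: of_int_eq_iff)
  qed
  finally show ?thesis by (auto simp: dvd_def)
qed

lemma e_mod_cong:
  assumes "p > 0" "[x = y] (mod int p)"
  shows "e_mod p x = e_mod p y"
proof -
  have "e_mod p (x - y) = 1"
    using assms by (simp add: e_mod_eq_1_iff cong_iff_dvd_diff)
  thus ?thesis using e_mod_add[of p "x - y" y] by simp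
qed

lemma Fp_eq_image: "Fp p = int ` {..<p}"
  unfolding Fp_def by (metis image_int_atLeastLessThan lessThan_atLeast0 of_nat_0)

text \<open>Orthogonality of characters: a geometric progression whose ratio
  \<open>e_mod p c\<close> is a p-th root of unity.\<close>

lemma sum_e_mod:
  assumes "p > 0"
  shows "(\<Sum>x\<in>Fp p. e_mod p (x * c)) = (if int p dvd c then of_nat p else 0)"
proof -
  have "(\<Sum>x\<in>Fp p. e_mod p (x * c)) = (\<Sum>n<p. e_mod p c ^ n)"
    unfolding Fp_eq_image by (subst sum.reindex) (simp_all add: e_mod_of_nat_mult)
  also have "\<dots> = (if int p dvd c then of_nat p else 0)"
  proof (cases "int p dvd c")
    case True
    thus ?thesis using e_mod_eq_1_iff[OF assms, of c] by simp
  next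
    case False
    have "e_mod p c ^ p = 1"
      using e_mod_of_nat_mult[of p p c] e_mod_eq_1_iff[OF assms, of "int p * c"] by simp
    thus ?thesis using False e_mod_eq_1_iff[OF assms, of c] by (simp add: geometric_sum)
  qed
  finally show ?thesis .
qed


section \<open>Inverses modulo a prime and the functions e_p(d / k)\<close>

locale prime_modulus =
  fixes p :: nat
  assumes prime_p: "prime p"
begin

lemma p_pos [simp]: "p > 0"
  using prime_p by (rule prime_gt_0_nat)

lemma prime_int_p: "prime (int p)"
  using prime_p by simp

lemma coprime_p_iff: "coprime k (int p) \<longleftrightarrow> \<not> int p dvd k"
  using prime_int_p by (metis coprime_commute prime_imp_coprime_int not_prime_unit coprime_absorb_left)

abbreviation inv_p :: "int \<Rightarrow> int" where
  "inv_p k \<equiv> modular_inverse (int p) k"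

lemma inv_p_right: "\<not> int p dvd k \<Longrightarrow> [k * inv_p k = 1] (mod int p)"
  by (rule cong_modular_inverse1) (simp add: coprime_p_iff)

lemma not_dvd_inv_p: "\<not> int p dvd k \<Longrightarrow> \<not> int p dvd inv_p k"
  by (metis coprime_modular_inverse coprime_p_iff)

lemma cong_cancel_left:
  assumes "\<not> int p dvd k" "[k * x = k * y] (mod int p)"
  shows "[x = y] (mod int p)"
  using assms by (simp add: cong_mult_lcancel coprime_p_iff)

lemma inv_p_unique:
  assumes "[k * y = 1] (mod int p)"
  shows "[inv_p k = y] (mod int p)"
proof -
  have k: "\<not> int p dvd k"
    by (metis assms cong_dvd_iff dvd_mult2 not_prime_unit prime_int_p)
  show ?thesis
    using cong_cancel_left[OF k, of "inv_p k" y] assms inv_p_right[OF k] cong_trans cong_sym by blast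
qed

lemma inv_p_cong:
  assumes "[k = k'] (mod int p)"
  shows "inv_p k = inv_p k'"
proof (cases "int p dvd k")
  case True
  \<comment> \<open>\<open>modular_inverse\<close> has one and the same default value at all
    non-units, so a genuine equality holds here too.\<close>
  hence "\<not> coprime k (int p)" "\<not> coprime k' (int p)"
    using assms coprime_p_iff cong_dvd_iff by blast+
  thus ?thesis by simp
next
  case False
  hence k': "\<not> int p dvd k'" using assms cong_dvd_iff by blast
  have "[k * inv_p k' = 1] (mod int p)"
    using inv_p_right[OF k'] assms cong_mult[OF assms cong_refl] cong_trans by blast
  hence "[inv_p k = inv_p k'] (mod int p)" by (rule inv_p_unique)
  thus ?thesis
    using modular_inverse_int_less[of "int p"] modular_inverse_int_nonneg[of "int p"]
    by (intro cong_less_imp_eq_int[of _ "int p"]) auto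
qed

text \<open>The value 0 at multiples of \<open>p\<close> makes this a periodic function of all
  integers \<open>k\<close>, so the enlarged intervals of both majorants may run across multiples of
  \<open>p\<close>, and the product rule in \<open>d\<close> survives there.\<close>

definition inv_char :: "int \<Rightarrow> int \<Rightarrow> complex" where
  "inv_char d k = (if int p dvd k then 0 else e_mod p (d * inv_p k))"

lemma norm_inv_char_le: "cmod (inv_char d k) \<le> 1"
  by (simp add: inv_char_def)

lemma inv_char_cong:
  assumes "[d = d'] (mod int p)" "[k = k'] (mod int p)"
  shows "inv_char d k = inv_char d' k'"
proof -
  have "int p dvd k \<longleftrightarrow> int p dvd k'" using assms cong_dvd_iff by blast
  moreover have "e_mod p (d * inv_p k) = e_mod p (d' * inv_p k)"
    using assms by (intro e_mod_cong cong_mult) auto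
  ultimately show ?thesis using inv_p_cong[OF assms(2)] by (simp add: inv_char_def)
qed

lemma inv_char_mult_cnj: "inv_char d k * cnj (inv_char d' k) = inv_char (d - d') k"
  by (simp add: inv_char_def cnj_e_mod e_mod_add[symmetric] left_diff_distrib)

text \<open>Divide numerator and denominator of d / (k + u v) by u. Reducing both new arguments
  modulo \<open>p\<close> makes the inner sum over \<open>v\<close> a function on the finite set
  \<open>Fp p \<times> Fp p\<close>, whose fibres can be counted.\<close>

lemma inv_char_dilate:
  assumes "\<not> int p dvd u"
  shows "inv_char d (k + u * v) = inv_char (d * inv_p u mod int p) (k * inv_p u mod int p + v)"
proof -
  define w where "w = k * inv_p u + v"
  have uw: "[u * w = k + u * v] (mod int p)"
  proof -
    have "[k * (u * inv_p u) + u * v = k * 1 + u * v] (mod int p)"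
      using inv_p_right[OF assms] by (intro cong_add cong_mult cong_refl)
    thus ?thesis by (simp add: w_def algebra_simps)
  qed
  have w: "[k * inv_p u mod int p + v = w] (mod int p)"
    unfolding w_def by (intro cong_add cong_refl) simp
  have d: "[d * inv_p u mod int p = d * inv_p u] (mod int p)" by simp
  have "inv_char d (k + u * v) = inv_char d (u * w)"
    by (rule inv_char_cong[OF cong_refl cong_sym[OF uw]])
  also have "\<dots> = inv_char (d * inv_p u) w"
  proof (cases "int p dvd w")
    case False
    have "[(u * w) * (inv_p u * inv_p w) = 1] (mod int p)"
      using cong_mult[OF inv_p_right[OF assms] inv_p_right[OF False]] by (simp add: mult_ac)
    hence "[inv_p (u * w) = inv_p u * inv_p w] (mod int p)" by (rule inv_p_unique)
    hence "[d * inv_p (u * w) = d * inv_p u * inv_p w] (mod int p)"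
      by (simp add: mult.assoc cong_mult)
    thus ?thesis
      using False assms prime_int_p
      by (simp add: inv_char_def prime_dvd_mult_iff e_mod_cong[OF p_pos])
  qed (simp add: inv_char_def)
  also have "\<dots> = inv_char (d * inv_p u mod int p) (k * inv_p u mod int p + v)"
    by (rule inv_char_cong[OF cong_sym[OF d] cong_sym[OF w]])
  finally show ?thesis .
qed

end

section \<open>Moments of short sums over reciprocals\<close>

context prime_modulus
begin

text \<open>Lagrange's theorem by splitting off roots with synthetic division over the integers.
  Being nonzero modulo \<open>p\<close> is expressed by a point \<open>a\<close> of non-vanishing,
  which passes to the quotient: if \<open>p\<close> divided its value at \<open>a\<close>, it would
  divide that of \<open>f\<close>.\<close>

lemma roots_mod_prime_le_degree:
  fixes f :: "int poly"
  assumes "\<not> int p dvd poly f a"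
  shows "card {y \<in> Fp p. int p dvd poly f y} \<le> degree f"
  using assms
proof (induction "degree f" arbitrary: f)
  case 0
  then obtain c where "f = [:c:]" by (metis degree_eq_zeroE)
  with 0 show ?case by simp
next
  case (Suc n)
  show ?case
  proof (cases "{y \<in> Fp p. int p dvd poly f y} = {}")
    case False
    then obtain b where b: "b \<in> Fp p" "int p dvd poly f b" by auto
    define g where "g = synthetic_div f b"
    have f: "poly f y = (y - b) * poly g y + poly f b" for y
      using arg_cong[OF synthetic_div_correct'[of b f], of "\<lambda>q. poly q y"]
      by (simp add: g_def algebra_simps)
    have "degree g = n" using Suc by (simp add: g_def degree_synthetic_div)
    moreover have "\<not> int p dvd poly g a"
      using Suc.prems b(2) f[of a] by (metis dvd_add dvd_mult)
    ultimately have IH: "card {y \<in> Fp p. int p dvd poly g y} \<le> n"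
      using Suc.hyps(1) by blast
    have "{y \<in> Fp p. int p dvd poly f y} \<subseteq> insert b {y \<in> Fp p. int p dvd poly g y}"
    proof
      fix y assume y: "y \<in> {y \<in> Fp p. int p dvd poly f y}"
      hence "int p dvd (y - b) * poly g y"
        using f[of y] b(2) by (metis (no_types, lifting) dvd_add_left_iff mem_Collect_eq)
      hence "int p dvd y - b \<or> int p dvd poly g y"
        using prime_int_p by (simp add: prime_dvd_mult_iff)
      moreover have "y = b" if "int p dvd y - b"
        using that y b by (metis (no_types, lifting) Fp_def atLeastLessThan_iff cong_iff_dvd_diff cong_less_imp_eq_int mem_Collect_eq)
      ultimately show "y \<in> insert b {y \<in> Fp p. int p dvd poly g y}" using y by auto
    qed
    hence "card {y \<in> Fp p. int p dvd poly f y} \<le> card (insert b {y \<in> Fp p. int p dvd poly g y})"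
      by (intro card_mono) auto
    also have "\<dots> \<le> Suc n" using IH by (intro card_insert_le_m1) auto
    finally show ?thesis using Suc by simp
  qed (metis card.empty le0)
qed

text \<open>Clearing denominators leaves a polynomial that does not vanish at the pole \<open>- g j\<close>, where
  only the summands with \<open>g i = g j\<close> survive.\<close>

lemma card_zeros_reciprocal_sum:
  fixes g :: "nat \<Rightarrow> int" and s :: "nat \<Rightarrow> int"
  assumes g: "\<And>i. i < n \<Longrightarrow> g i \<in> {1..int V}" and V: "V < p" and j: "j < n"
    and s: "\<not> int p dvd (\<Sum>i | i < n \<and> g i = g j. s i)"
  shows "card {y \<in> Fp p. (\<forall>i<n. \<not> int p dvd y + g i) \<and> int p dvd (\<Sum>i<n. s i * inv_p (y + g i))} \<le> n"
proof -
  define W where "W = g ` {..<n}"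
  \<comment> \<open>The common denominator has one factor for each distinct value in
    \<open>W\<close>. With one factor per index, a value \<open>g j\<close> attained twice would
    make every summand vanish at the pole.\<close>
  define f where "f = (\<Sum>i<n. Polynomial.smult (s i) (\<Prod>w\<in>W - {g i}. [:w, 1:]))"
  have [simp]: "finite W" by (simp add: W_def)
  have card_W: "card W \<le> n" unfolding W_def by (metis card_image_le card_lessThan finite_lessThan)
  have poly_f: "poly f y = (\<Sum>i<n. s i * (\<Prod>w\<in>W - {g i}. y + w))" for y
    by (simp add: f_def poly_sum poly_prod add.commute)
  have "degree f \<le> n"
    unfolding f_def
  proof (intro degree_sum_le)
    fix i assume "i \<in> {..<n}"
    have "degree (Polynomial.smult (s i) (\<Prod>w\<in>W - {g i}. [:w, 1:])) \<le> degree (\<Prod>w\<in>W - {g i}. [:w, 1:])"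
      by (rule degree_smult_le)
    also have "\<dots> \<le> (\<Sum>w\<in>W - {g i}. 1)"
      by (rule order.trans[OF degree_prod_sum_le]) simp_all
    also have "\<dots> \<le> n" using card_W card_Diff1_le[of W "g i"] by (simp del: card_Diff_insert)
    finally show "degree (Polynomial.smult (s i) (\<Prod>w\<in>W - {g i}. [:w, 1:])) \<le> n" .
  qed auto
  moreover have "\<not> int p dvd poly f (- g j)"
  proof -
    have "poly f (- g j) = (\<Sum>i<n. if g i = g j then s i * (\<Prod>w\<in>W - {g j}. w - g j) else 0)"
      unfolding poly_f
    proof (intro sum.cong refl)
      fix i assume i: "i \<in> {..<n}"
      show "s i * (\<Prod>w\<in>W - {g i}. - g j + w) = (if g i = g j then s i * (\<Prod>w\<in>W - {g j}. w - g j) else 0)"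
      proof (cases "g i = g j")
        case False
        hence "(\<Prod>w\<in>W - {g i}. - g j + w) = 0"
          using j by (intro prod_zero bexI[of _ "g j"]) (auto simp: W_def)
        thus ?thesis using False by simp
      qed (simp add: add.commute)
    qed
    also have "\<dots> = (\<Sum>i | i < n \<and> g i = g j. s i) * (\<Prod>w\<in>W - {g j}. w - g j)"
      by (simp add: sum.inter_filter[symmetric] sum_distrib_right lessThan_def)
    finally have eq: "poly f (- g j) = (\<Sum>i | i < n \<and> g i = g j. s i) * (\<Prod>w\<in>W - {g j}. w - g j)" .
    have "\<not> int p dvd w - g j" if "w \<in> W - {g j}" for w
    proof -
      have "w \<in> {1..int V}" "g j \<in> {1..int V}" "w \<noteq> g j" using that g j by (auto simp: W_def)
      thus ?thesis using V dvd_imp_le_int[of "w - g j" "int p"] by auto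
    qed
    thus ?thesis using eq s prime_int_p by (simp add: prime_dvd_mult_iff prime_dvd_prod_iff)
  qed
  moreover have "int p dvd poly f y"
    if y: "\<forall>i<n. \<not> int p dvd y + g i" "int p dvd (\<Sum>i<n. s i * inv_p (y + g i))" for y
  proof -
    have "[s i * (\<Prod>w\<in>W - {g i}. y + w) = (s i * inv_p (y + g i)) * (\<Prod>w\<in>W. y + w)] (mod int p)"
      if i: "i \<in> {..<n}" for i
    proof -
      have "(\<Prod>w\<in>W. y + w) = (y + g i) * (\<Prod>w\<in>W - {g i}. y + w)"
        using i by (intro prod.remove) (auto simp: W_def)
      hence "(s i * inv_p (y + g i)) * (\<Prod>w\<in>W. y + w)
          = ((y + g i) * inv_p (y + g i)) * (s i * (\<Prod>w\<in>W - {g i}. y + w))"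
        by simp
      moreover have "[((y + g i) * inv_p (y + g i)) * (s i * (\<Prod>w\<in>W - {g i}. y + w))
          = 1 * (s i * (\<Prod>w\<in>W - {g i}. y + w))] (mod int p)"
        using y i by (intro cong_mult cong_refl inv_p_right) auto
      ultimately show ?thesis by (metis cong_sym mult_1)
    qed
    hence "[poly f y = (\<Sum>i<n. (s i * inv_p (y + g i)) * (\<Prod>w\<in>W. y + w))] (mod int p)"
      unfolding poly_f by (intro cong_sum)
    thus ?thesis using y(2) by (simp add: sum_distrib_right[symmetric] cong_dvd_iff)
  qed
  ultimately show ?thesis
    using roots_mod_prime_le_degree[of f "- g j"]
      card_mono[of "{y \<in> Fp p. int p dvd poly f y}"
        "{y \<in> Fp p. (\<forall>i<n. \<not> int p dvd y + g i) \<and> int p dvd (\<Sum>i<n. s i * inv_p (y + g i))}"]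
    by fastforce
qed

text \<open>Expand Z^r times the r-th power of its conjugate as a product of 2r sums; the sign
  \<open>s\<close> marks the conjugated factors. A tuple meeting a multiple of \<open>p\<close>
  contributes nothing because \<open>inv_char\<close> is 0 there.\<close>

lemma inv_char_sum_power:
  fixes x y :: int and V r :: nat
  defines "s \<equiv> \<lambda>i. if i < r then 1 else - 1 :: int"
  shows "complex_of_real (cmod (\<Sum>v\<in>{1..int V}. inv_char x (y + v)) ^ (2 * r)) =
    (\<Sum>g\<in>PiE {..<2 * r} (\<lambda>_. {1..int V}). if \<forall>i<2 * r. \<not> int p dvd y + g i
      then e_mod p (x * (\<Sum>i<2 * r. s i * inv_p (y + g i))) else 0)"
proof -
  define Z where "Z = (\<Sum>v\<in>{1..int V}. inv_char x (y + v))"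
  define f where "f = (\<lambda>i v. if int p dvd y + v then 0 else e_mod p (x * (s i * inv_p (y + v))))"
  have "complex_of_real (cmod Z ^ (2 * r)) = (complex_of_real ((cmod Z)\<^sup>2)) ^ r"
    by (simp add: power_mult)
  also have "\<dots> = Z ^ r * cnj Z ^ r"
    by (simp only: complex_norm_square power_mult_distrib)
  also have "\<dots> = (\<Prod>i<2 * r. if i < r then Z else cnj Z)"
  proof -
    have "{..<2 * r} \<inter> {i. i < r} = {..<r}" "{..<2 * r} \<inter> - {i. i < r} = {r..<2 * r}" by auto
    thus ?thesis by (simp add: prod.If_cases)
  qed
  also have "\<dots> = (\<Prod>i<2 * r. \<Sum>v\<in>{1..int V}. f i v)"
    by (intro prod.cong refl)
       (auto simp: Z_def f_def s_def inv_char_def cnj_e_mod cnj_sum if_distrib cong: if_cong)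
  also have "\<dots> = (\<Sum>g\<in>PiE {..<2 * r} (\<lambda>_. {1..int V}). \<Prod>i<2 * r. f i (g i))"
    by (rule prod_sum_PiE) auto
  also have "\<dots> = (\<Sum>g\<in>PiE {..<2 * r} (\<lambda>_. {1..int V}). if \<forall>i<2 * r. \<not> int p dvd y + g i
      then e_mod p (x * (\<Sum>i<2 * r. s i * inv_p (y + g i))) else 0)"
  proof (intro sum.cong refl)
    fix g
    show "(\<Prod>i<2 * r. f i (g i)) = (if \<forall>i<2 * r. \<not> int p dvd y + g i
        then e_mod p (x * (\<Sum>i<2 * r. s i * inv_p (y + g i))) else 0)"
    proof (cases "\<forall>i<2 * r. \<not> int p dvd y + g i")
      case True
      thus ?thesis by (simp add: f_def sum_distrib_left e_mod_sum)
    next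
      case False
      then obtain i where "i < 2 * r" "f i (g i) = 0" by (auto simp: f_def)
      thus ?thesis using False by (auto intro!: prod_zero)
    qed
  qed
  finally show ?thesis by (simp add: Z_def)
qed

text \<open>Summing over \<open>x\<close> leaves, for each tuple, the zeros \<open>y\<close> of a
  signed sum of reciprocals. The sum can degenerate only if every value in the second half also
  occurs in the first; these tuples form \<open>G0\<close>, are few, and are allowed all
  \<open>p\<close> values of \<open>y\<close>. Every other tuple has at most 2r zeros.\<close>

lemma inv_char_moment:
  assumes V: "V < p" and r: "0 < r" "r < p"
  shows "(\<Sum>x\<in>Fp p. \<Sum>y\<in>Fp p. cmod (\<Sum>v\<in>{1..int V}. inv_char x (y + v)) ^ (2 * r))
    \<le> real p * (real r ^ r * real V ^ r * real p + 2 * real r * real V ^ (2 * r))"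
proof -
  define s where "s = (\<lambda>i. if i < r then 1 else - 1 :: int)"
  define G where "G = PiE {..<2 * r} (\<lambda>_. {1..int V})"
  define T where "T = (\<lambda>y g. (\<Sum>i<2 * r. s i * inv_p (y + g i)))"
  define P where "P = (\<lambda>y g. \<forall>i<2 * r. \<not> int p dvd y + g i)"
  define R where "R = (\<lambda>g. {y \<in> Fp p. P y g \<and> int p dvd T y g})"
  define G0 where "G0 = {g \<in> G. \<forall>j\<in>{r..<2 * r}. \<exists>i<r. g j = g i}"
  have [simp]: "finite G" by (simp add: G_def finite_PiE)
  have "complex_of_real (\<Sum>x\<in>Fp p. \<Sum>y\<in>Fp p. cmod (\<Sum>v\<in>{1..int V}. inv_char x (y + v)) ^ (2 * r))
      = (\<Sum>x\<in>Fp p. \<Sum>y\<in>Fp p. \<Sum>g\<in>G. if P y g then e_mod p (x * T y g) else 0)"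
    unfolding of_real_sum inv_char_sum_power P_def T_def s_def G_def by (rule refl)
  also have "\<dots> = (\<Sum>y\<in>Fp p. \<Sum>x\<in>Fp p. \<Sum>g\<in>G. if P y g then e_mod p (x * T y g) else 0)"
    by (rule sum.swap)
  also have "\<dots> = (\<Sum>y\<in>Fp p. \<Sum>g\<in>G. \<Sum>x\<in>Fp p. if P y g then e_mod p (x * T y g) else 0)"
    by (intro sum.cong refl sum.swap)
  also have "\<dots> = (\<Sum>g\<in>G. \<Sum>y\<in>Fp p. \<Sum>x\<in>Fp p. if P y g then e_mod p (x * T y g) else 0)"
    by (rule sum.swap)
  also have "\<dots> = (\<Sum>g\<in>G. \<Sum>y\<in>Fp p. if P y g \<and> int p dvd T y g then of_nat p else 0)"
  proof (intro sum.cong refl)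
    fix g y
    show "(\<Sum>x\<in>Fp p. if P y g then e_mod p (x * T y g) else 0)
        = (if P y g \<and> int p dvd T y g then of_nat p else 0)"
      by (cases "P y g") (simp_all add: sum_e_mod)
  qed
  also have "\<dots> = complex_of_real (real p * (\<Sum>g\<in>G. real (card (R g))))"
    by (simp add: sum.inter_filter[symmetric] R_def sum_distrib_left mult.commute)
  finally have eq: "(\<Sum>x\<in>Fp p. \<Sum>y\<in>Fp p. cmod (\<Sum>v\<in>{1..int V}. inv_char x (y + v)) ^ (2 * r))
      = real p * (\<Sum>g\<in>G. real (card (R g)))"
    by (simp only: of_real_eq_iff)

  have "card G0 \<le> card (PiE {..<r} (\<lambda>_. {1..int V}) \<times> PiE {r..<2 * r} (\<lambda>_. {..<r}))"
  \<comment> \<open>A tuple in \<open>G0\<close> is recovered from its first half \<open>u\<close>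
    and a map \<open>h\<close> sending each position of the second half to a position of the first
    half with the same value: V^r times r^r choices.\<close>
  proof (rule surj_card_le[where f = "\<lambda>(u, h). \<lambda>i\<in>{..<2 * r}. if i < r then u i else u (h i)"])
    show "G0 \<subseteq> (\<lambda>(u, h). \<lambda>i\<in>{..<2 * r}. if i < r then u i else u (h i)) `
        (PiE {..<r} (\<lambda>_. {1..int V}) \<times> PiE {r..<2 * r} (\<lambda>_. {..<r}))"
    proof
      fix g assume g: "g \<in> G0"
      hence "\<forall>j\<in>{r..<2 * r}. \<exists>i. i < r \<and> g j = g i" by (auto simp: G0_def)
      from bchoice[OF this] obtain h where h: "\<And>j. j \<in> {r..<2 * r} \<Longrightarrow> h j < r \<and> g j = g (h j)"
        by blast
      have "g = (\<lambda>i\<in>{..<2 * r}. if i < r then restrict g {..<r} i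
          else restrict g {..<r} (restrict h {r..<2 * r} i))"
        using g h by (auto simp: G0_def G_def fun_eq_iff PiE_def extensional_def)
      moreover have "restrict g {..<r} \<in> PiE {..<r} (\<lambda>_. {1..int V})"
        using g by (auto simp: G0_def G_def PiE_def Pi_def)
      moreover have "restrict h {r..<2 * r} \<in> PiE {r..<2 * r} (\<lambda>_. {..<r})"
        using h by auto
      ultimately show "g \<in> (\<lambda>(u, h). \<lambda>i\<in>{..<2 * r}. if i < r then u i else u (h i)) `
          (PiE {..<r} (\<lambda>_. {1..int V}) \<times> PiE {r..<2 * r} (\<lambda>_. {..<r}))"
        by (intro image_eqI[of _ _ "(restrict g {..<r}, restrict h {r..<2 * r})"]) auto
    qed
  qed (simp add: finite_PiE)
  hence G0: "real (card G0) \<le> real r ^ r * real V ^ r"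
    by (simp add: card_cartesian_product card_PiE mult.commute flip: of_nat_power of_nat_mult)

  have R1: "card (R g) \<le> p" for g
    using card_mono[of "Fp p" "R g"] by (auto simp: R_def)
  have R2: "card (R g) \<le> 2 * r" if g: "g \<in> G - G0" for g
  proof -
    obtain j where j: "r \<le> j" "j < 2 * r" "\<And>i. i < r \<Longrightarrow> g j \<noteq> g i"
      using g by (force simp: G0_def)
    define J where "J = {i. i < 2 * r \<and> g i = g j}"
    \<comment> \<open>All positions with value \<open>g j\<close> carry the sign -1, so nothing
      cancels: the coefficient at this pole lies between -r and -1 and is a unit because r <
      p.\<close>
    have sub: "J \<subseteq> {r..<2 * r}" unfolding J_def using j(3) by (force simp: not_less)
    hence "(\<Sum>i\<in>J. s i) = (\<Sum>i\<in>J. - 1)" by (intro sum.cong) (auto simp: s_def)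
    hence sum: "(\<Sum>i\<in>J. s i) = - int (card J)" by simp
    have "finite J" unfolding J_def by simp
    hence "card J > 0" "card J \<le> r"
      using j card_mono[OF _ sub] by (auto simp: J_def card_gt_0_iff)
    hence "\<not> int p dvd (\<Sum>i\<in>J. s i)"
      using r unfolding sum by (simp add: nat_dvd_not_less)
    thus ?thesis
      unfolding R_def P_def T_def J_def using g V j
      by (intro card_zeros_reciprocal_sum) (auto simp: G_def PiE_def Pi_def)
  qed
  have "(\<Sum>g\<in>G. real (card (R g))) = (\<Sum>g\<in>G0. real (card (R g))) + (\<Sum>g\<in>G - G0. real (card (R g)))"
    by (subst sum.subset_diff[of G0]) (auto simp: G0_def add.commute)
  also have "\<dots> \<le> (\<Sum>g\<in>G0. real p) + (\<Sum>g\<in>G - G0. real (2 * r))"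
    using R1 R2 by (intro add_mono sum_mono of_nat_mono) auto
  also have "\<dots> \<le> real r ^ r * real V ^ r * real p + 2 * real r * real V ^ (2 * r)"
  proof -
    have "card (G - G0) \<le> card G" by (intro card_mono) auto
    also have "card G = V ^ (2 * r)" by (simp add: G_def card_PiE)
    finally have "real (card (G - G0)) \<le> real V ^ (2 * r)" by (simp flip: of_nat_power)
    hence "real (card (G - G0)) * (2 * real r) \<le> real V ^ (2 * r) * (2 * real r)"
      by (intro mult_right_mono) auto
    moreover have "real (card G0) * real p \<le> real r ^ r * real V ^ r * real p"
      using G0 by (intro mult_right_mono) auto
    ultimately have "real (card G0) * real p + real (card (G - G0)) * (2 * real r)
        \<le> real r ^ r * real V ^ r * real p + real V ^ (2 * r) * (2 * real r)"
      by (intro add_mono)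
    thus ?thesis by (simp add: mult_ac)
  qed
  finally show ?thesis unfolding eq by (intro mult_left_mono) auto
qed

end

section \<open>Lattice points and the energy of ratios\<close>

text \<open>On the box the form \<open>b * x - a * y\<close> stays within b L of \<open>C\<close>,
  so at most 2 + 2 b L / p multiples of \<open>p\<close> occur as values. On a level set coprimality
  fixes \<open>y\<close> modulo \<open>b\<close>, which leaves at most 1 + L / b points. The
  assumption a <= b makes the larger coefficient the step length.\<close>

lemma card_lattice_box_aux:
  fixes a b X Y :: int and p L :: nat
  assumes ab: "coprime a b" "0 < a" "a \<le> b" and p: "0 < p"
  shows "real (card {(x, y). x \<in> {X + 1..X + int L} \<and> y \<in> {Y + 1..Y + int L} \<and> int p dvd b * x - a * y})
    \<le> (1 + real L / real_of_int b) * (2 + 2 * real_of_int b * real L / real p)"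
proof -
  define S where "S = {(x, y). x \<in> {X + 1..X + int L} \<and> y \<in> {Y + 1..Y + int L} \<and> int p dvd b * x - a * y}"
  define C where "C = b * (X + 1) - a * (Y + 1)"
  define N where "N = {(C - b * int L) div int p..(C + b * int L) div int p}"
  \<comment> \<open>The first coordinate identifies the level set, the second the block of
    \<open>b\<close> consecutive integers containing \<open>y\<close>; a level set has at most one
    point per block.\<close>
  define f where "f = (\<lambda>(x, y). ((b * x - a * y) div int p, (y - Y - 1) div b))"
  have b: "b > 0" using ab by simp
  have "inj_on f S"
  proof (rule inj_onI, clarify)
    fix x y x' y' assume xy: "(x, y) \<in> S" "(x', y') \<in> S" "f (x, y) = f (x', y')"
    have "(b * x - a * y) div int p = (b * x' - a * y') div int p"
      "int p dvd b * x - a * y" "int p dvd b * x' - a * y'"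
      using xy by (auto simp: f_def S_def)
    hence "b * x - a * y = b * x' - a * y'" by (metis dvd_div_mult_self)
    hence eq: "b * (x - x') = a * (y - y')" by (simp add: algebra_simps)
    hence "b dvd y - y'" using ab(1) by (metis coprime_commute coprime_dvd_mult_right_iff dvd_triv_left)
    hence "(y - Y - 1) mod b = (y' - Y - 1) mod b" by (simp add: mod_eq_dvd_iff)
    moreover have "(y - Y - 1) div b = (y' - Y - 1) div b" using xy by (simp add: f_def)
    ultimately have "y - Y - 1 = y' - Y - 1" by (metis div_mult_mod_eq)
    thus "x = x' \<and> y = y'" using eq b by simp
  qed
  moreover have "f ` S \<subseteq> N \<times> {0..int L div b}"
  proof (rule image_subsetI)
    fix z assume "z \<in> S"
    then obtain x y where z: "z = (x, y)" and xy: "(x, y) \<in> S" by (cases z) auto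
    define x' y' where "x' = x - X - 1" and "y' = y - Y - 1"
    have x': "0 \<le> x'" "x' \<le> int L" and y': "0 \<le> y'" "y' \<le> int L"
      using xy by (auto simp: x'_def y'_def S_def)
    have eq: "b * x - a * y = C + b * x' - a * y'" by (simp add: C_def x'_def y'_def algebra_simps)
    have "b * x' \<le> b * int L" "0 \<le> b * x'" "a * y' \<le> b * int L" "0 \<le> a * y'"
      using x' y' ab b by (auto intro!: mult_mono)
    hence "C - b * int L \<le> b * x - a * y" "b * x - a * y \<le> C + b * int L" unfolding eq by auto
    hence "(b * x - a * y) div int p \<in> N" by (auto simp: N_def intro!: zdiv_mono1 p)
    moreover have "y' div b \<in> {0..int L div b}"
      using y' b by (auto simp: pos_imp_zdiv_nonneg_iff zdiv_mono1)
    ultimately show "f z \<in> N \<times> {0..int L div b}" by (simp add: z f_def y'_def)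
  qed
  ultimately have "card S \<le> card (N \<times> {0..int L div b})"
    by (rule card_inj_on_le) (simp add: N_def)
  hence "real (card S) \<le> real (card {0..int L div b}) * real (card N)"
    by (simp add: card_cartesian_product mult.commute flip: of_nat_mult)
  also have "\<dots> \<le> (1 + real L / real_of_int b) * (2 + 2 * real_of_int b * real L / real p)"
  proof (intro mult_mono)
    have "0 \<le> int L div b" using b by (simp add: pos_imp_zdiv_nonneg_iff)
    hence "real (card {0..int L div b}) = 1 + real_of_int (int L div b)" by simp
    also have "real_of_int (int L div b) \<le> real L / real_of_int b"
      using real_of_int_div4[of "int L" b] by simp
    finally show "real (card {0..int L div b}) \<le> 1 + real L / real_of_int b" by simp
    \<comment> \<open>Rounding down the lower end point and counting both ends inclusively account
      for the summand 2.\<close>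
    let ?lo = "(C - b * int L) div int p" and ?hi = "(C + b * int L) div int p"
    have "?lo \<le> ?hi" using b p by (intro zdiv_mono1) auto
    hence "real (card N) = real_of_int ?hi - real_of_int ?lo + 1" by (simp add: N_def)
    moreover have "real_of_int ?hi \<le> real_of_int (C + b * int L) / real p"
      using real_of_int_div4[of "C + b * int L" "int p"] by simp
    moreover have "real_of_int (C - b * int L) / real p \<le> real_of_int ?lo + 1"
      using real_of_int_div3[of "C - b * int L" "int p"] by simp
    ultimately show "real (card N) \<le> 2 + 2 * real_of_int b * real L / real p"
      by (simp add: add_divide_distrib diff_divide_distrib)
  qed (use b in auto)
  finally show ?thesis by (simp add: S_def)
qed

text \<open>The form \<open>b * x - a * y\<close> takes few values on the box, and each level set meets it in
  translates by multiples of \<open>(a, b)\<close>.\<close>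

lemma card_lattice_box:
  fixes a b X Y :: int and p L :: nat
  assumes ab: "coprime a b" "0 < a" "0 < b" and p: "0 < p"
  shows "real (card {(x, y). x \<in> {X + 1..X + int L} \<and> y \<in> {Y + 1..Y + int L} \<and> int p dvd b * x - a * y})
    \<le> (1 + real L / real_of_int (max a b)) * (2 + 2 * real_of_int (max a b) * real L / real p)"
proof (cases "a \<le> b")
  case True
  thus ?thesis using card_lattice_box_aux[OF ab(1,2) True p, of X L Y] by (simp add: max_def)
next
  case False
  have "bij_betw prod.swap
      {(x, y). x \<in> {X + 1..X + int L} \<and> y \<in> {Y + 1..Y + int L} \<and> int p dvd b * x - a * y}
      {(x, y). x \<in> {Y + 1..Y + int L} \<and> y \<in> {X + 1..X + int L} \<and> int p dvd a * x - b * y}"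
    by (rule bij_betwI[where g = prod.swap]) (auto simp: dvd_diff_commute)
  hence "card {(x, y). x \<in> {X + 1..X + int L} \<and> y \<in> {Y + 1..Y + int L} \<and> int p dvd b * x - a * y}
      = card {(x, y). x \<in> {Y + 1..Y + int L} \<and> y \<in> {X + 1..X + int L} \<and> int p dvd a * x - b * y}"
    by (rule bij_betw_same_card)
  thus ?thesis
    using card_lattice_box_aux[of b a p Y L X] ab False p by (simp add: max_def coprime_commute)
qed

context prime_modulus
begin

lemma cong_Fp_imp_eq:
  assumes "x \<in> Fp p" "y \<in> Fp p" "[x = y] (mod int p)"
  shows "x = y"
  using assms by (intro cong_less_imp_eq_int[of x "int p" y]) (auto simp: Fp_def)

text \<open>As a / b represents \<mu>, both sets lie in the lattice b x = a y modulo
  \<open>p\<close>, in boxes of side \<open>U\<close> and \<open>L\<close>. Since t = max a b <= U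
  <= L, the summand 1 in 1 + n / t is absorbed, and both counts get the common factor 1 / t + L /
  p.\<close>

lemma ratio_pair_count:
  fixes a b \<mu> :: int and U L :: nat
  assumes ab: "coprime a b" "a \<in> {1..int U}" "b \<in> {1..int U}" "[a = \<mu> * b] (mod int p)" and UL: "U \<le> L"
  shows "real (card {(u, u'). u \<in> {1..int U} \<and> u' \<in> {1..int U} \<and> [u = \<mu> * u'] (mod int p)})
      * real (card {(k, k'). k \<in> {X + 1..X + int L} \<and> k' \<in> {X + 1..X + int L} \<and> [k = \<mu> * k'] (mod int p)})
    \<le> 32 * real U * real L * (1 / (real_of_int a * real_of_int b) + (real L)\<^sup>2 / (real p)\<^sup>2)"
proof -
  define t where "t = real_of_int (max a b)"
  have t: "0 < t" "t \<le> real U" using ab by (auto simp: t_def)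
  have box: "real (card {(x, y). x \<in> {Y + 1..Y + int n} \<and> y \<in> {Y + 1..Y + int n} \<and> [x = \<mu> * y] (mod int p)})
      \<le> 4 * real n * (1 / t + real L / real p)" if n: "U \<le> n" "n \<le> L" for Y n
  proof -
    have "{(x, y). x \<in> {Y + 1..Y + int n} \<and> y \<in> {Y + 1..Y + int n} \<and> [x = \<mu> * y] (mod int p)}
        \<subseteq> {(x, y). x \<in> {Y + 1..Y + int n} \<and> y \<in> {Y + 1..Y + int n} \<and> int p dvd b * x - a * y}"
    proof clarify
      fix x y assume "[x = \<mu> * y] (mod int p)"
      hence "[b * x = b * (\<mu> * y)] (mod int p)" by (intro cong_mult cong_refl)
      also have "b * (\<mu> * y) = (\<mu> * b) * y" by simp
      also have "[\<dots> = a * y] (mod int p)" using ab(4) by (intro cong_mult cong_refl) (rule cong_sym)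
      finally show "int p dvd b * x - a * y" by (simp add: cong_iff_dvd_diff)
    qed
    hence "card {(x, y). x \<in> {Y + 1..Y + int n} \<and> y \<in> {Y + 1..Y + int n} \<and> [x = \<mu> * y] (mod int p)}
        \<le> card {(x, y). x \<in> {Y + 1..Y + int n} \<and> y \<in> {Y + 1..Y + int n} \<and> int p dvd b * x - a * y}"
      by (rule card_mono[rotated]) (rule finite_subset[of _ "{Y + 1..Y + int n} \<times> {Y + 1..Y + int n}"], auto)
    hence "real (card {(x, y). x \<in> {Y + 1..Y + int n} \<and> y \<in> {Y + 1..Y + int n} \<and> [x = \<mu> * y] (mod int p)})
        \<le> (1 + real n / t) * (2 + 2 * t * real n / real p)"
      using card_lattice_box[OF ab(1), of p Y n Y] ab by (simp add: t_def)
    also have "\<dots> \<le> (2 * real n / t) * (2 * (1 + t * real L / real p))"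
    proof (intro mult_mono)
      show "1 + real n / t \<le> 2 * real n / t" using t n by (simp add: field_simps)
      have "t * real n / real p \<le> t * real L / real p"
        using t n by (intro divide_right_mono mult_left_mono) auto
      thus "2 + 2 * t * real n / real p \<le> 2 * (1 + t * real L / real p)" by simp
    qed (use t in auto)
    also have "\<dots> = 4 * real n * (1 / t + real L / real p)"
      using t(1) by (simp add: distrib_left add_divide_distrib)
    finally show ?thesis .
  qed
  define q where "q = real L / real p"
  have "real (card {(u, u'). u \<in> {1..int U} \<and> u' \<in> {1..int U} \<and> [u = \<mu> * u'] (mod int p)})
      * real (card {(k, k'). k \<in> {X + 1..X + int L} \<and> k' \<in> {X + 1..X + int L} \<and> [k = \<mu> * k'] (mod int p)})
    \<le> (4 * real U * (1 / t + q)) * (4 * real L * (1 / t + q))"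
    using box[of U 0] box[of L X] UL t unfolding q_def by (intro mult_mono) simp_all
  also have "\<dots> = 16 * real U * real L * (1 / t + q)\<^sup>2"
    by (simp add: power2_eq_square)
  also have "\<dots> \<le> 16 * real U * real L * (2 * (1 / t\<^sup>2 + q\<^sup>2))"
  proof (intro mult_left_mono)
    show "(1 / t + q)\<^sup>2 \<le> 2 * (1 / t\<^sup>2 + q\<^sup>2)"
      using sum_squares_bound[of "1 / t" q] by (simp add: power2_sum power_one_over)
  qed auto
  also have "\<dots> \<le> 16 * real U * real L * (2 * (1 / (real_of_int a * real_of_int b) + q\<^sup>2))"
  proof (intro mult_left_mono add_mono order.refl)
    \<comment> \<open>Weakening 1 / t^2 to 1 / (a b) makes the later sum over all fractions factor
      into two harmonic sums.\<close>
    have "real_of_int a * real_of_int b \<le> t * t" using ab t by (intro mult_mono) (auto simp: t_def)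
    thus "1 / t\<^sup>2 \<le> 1 / (real_of_int a * real_of_int b)"
      using ab t by (intro divide_left_mono) (auto simp: power2_eq_square)
  qed auto
  also have "\<dots> = 32 * real U * real L * (1 / (real_of_int a * real_of_int b) + (real L)\<^sup>2 / (real p)\<^sup>2)"
    by (simp add: q_def power_divide)
  finally show ?thesis .
qed

text \<open>Sort the coincidences of \<open>f\<close> by the ratio \<mu> = u / u' modulo
  \<open>p\<close>. Then m - n = \<mu> (m' - n') and k = \<mu> k' as well, so for fixed \<mu> the
  conditions on the differences, on the dilations and on the interval points decouple into
  \<open>A\<close>, \<open>B\<close> and \<open>D\<close>.\<close>

lemma ratio_energy_bound:
  fixes a X :: int and \<M> :: "int set" and U L :: nat
  assumes a: "\<not> int p dvd a" and \<M>: "\<M> \<subseteq> Fp p" and U: "U < p" "U \<le> L"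
  defines "\<Omega> \<equiv> {(m, n, u, k). m \<in> \<M> \<and> n \<in> \<M> \<and> m \<noteq> n \<and> u \<in> {1..int U} \<and> k \<in> {X + 1..X + int L}}"
  defines "f \<equiv> \<lambda>(m, n, u, k). (a * (m - n) * inv_p u mod int p, k * inv_p u mod int p)"
  shows "real (card {(\<omega>, \<omega>'). \<omega> \<in> \<Omega> \<and> \<omega>' \<in> \<Omega> \<and> f \<omega> = f \<omega>'})
    \<le> 32 * real U * real L * (real (card \<M>) ^ 3 * (harm U)\<^sup>2 + real (card \<M>) ^ 4 * (real L)\<^sup>2 / (real p)\<^sup>2)"
proof -
  define \<Lambda> where "\<Lambda> = {1..<int p}"
  define A where "A = (\<lambda>\<mu>. {(m, n, m', n'). m \<in> \<M> \<and> n \<in> \<M> \<and> m' \<in> \<M> \<and> n' \<in> \<M> \<and> m' \<noteq> n'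
      \<and> [m - n = \<mu> * (m' - n')] (mod int p)})"
  define B where "B = (\<lambda>\<mu>. {(u, u'). u \<in> {1..int U} \<and> u' \<in> {1..int U} \<and> [u = \<mu> * u'] (mod int p)})"
  define D where "D = (\<lambda>\<mu>. {(k, k'). k \<in> {X + 1..X + int L} \<and> k' \<in> {X + 1..X + int L}
      \<and> [k = \<mu> * k'] (mod int p)})"
  define \<Lambda>' where "\<Lambda>' = {\<mu> \<in> \<Lambda>. B \<mu> \<noteq> {}}"
  have fin_\<M>: "finite \<M>" using \<M> finite_Fp finite_subset by blast
  have fin_A: "finite (A \<mu>)" for \<mu>
    by (rule finite_subset[of _ "\<M> \<times> \<M> \<times> \<M> \<times> \<M>"]) (auto simp: A_def fin_\<M>)
  have fin_B: "finite (B \<mu>)" for \<mu>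
    by (rule finite_subset[of _ "{1..int U} \<times> {1..int U}"]) (auto simp: B_def)
  have fin_D: "finite (D \<mu>)" for \<mu>
    by (rule finite_subset[of _ "{X + 1..X + int L} \<times> {X + 1..X + int L}"]) (auto simp: D_def)
  have unit: "\<not> int p dvd u" if "u \<in> {1..int U}" for u
    using that U zdvd_not_zless[of u "int p"] by auto

  have fin_\<Lambda>': "finite \<Lambda>'" by (rule finite_subset[of _ \<Lambda>]) (auto simp: \<Lambda>'_def \<Lambda>_def)

  define E where "E = {(\<omega>, \<omega>'). \<omega> \<in> \<Omega> \<and> \<omega>' \<in> \<Omega> \<and> f \<omega> = f \<omega>'}"
  define g :: "(int \<times> int \<times> int \<times> int) \<times> (int \<times> int \<times> int \<times> int) \<Rightarrow>
      (int \<times> int \<times> int \<times> int) \<times> (int \<times> int) \<times> (int \<times> int)"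
    where "g = (\<lambda>((m, n, u, k), (m', n', u', k')). ((m, n, m', n'), (u, u'), (k, k')))"
  have "inj_on g E" by (auto simp: inj_on_def g_def)
  moreover have "g ` E \<subseteq> (\<Union>\<mu>\<in>\<Lambda>'. A \<mu> \<times> B \<mu> \<times> D \<mu>)"
  proof (rule image_subsetI)
    fix z assume "z \<in> E"
    moreover obtain m n u k m' n' u' k' where z: "z = ((m, n, u, k), (m', n', u', k'))"
      by (metis prod.collapse)
    ultimately have M: "m \<in> \<M>" "n \<in> \<M>" "m' \<in> \<M>" "n' \<in> \<M>" "m' \<noteq> n'" and u: "u \<in> {1..int U}" "u' \<in> {1..int U}"
      and k: "k \<in> {X + 1..X + int L}" "k' \<in> {X + 1..X + int L}"
      and eq: "[a * (m - n) * inv_p u = a * (m' - n') * inv_p u'] (mod int p)"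
        "[k * inv_p u = k' * inv_p u'] (mod int p)"
      by (simp_all add: E_def \<Omega>_def f_def cong_def)
    define \<mu> where "\<mu> = u * inv_p u' mod int p"
    have \<mu>: "[\<mu> = u * inv_p u'] (mod int p)" by (simp add: \<mu>_def)
    have "\<not> int p dvd \<mu>"
      using \<mu> unit[OF u(1)] not_dvd_inv_p[OF unit[OF u(2)]] prime_int_p
      by (simp add: cong_dvd_iff prime_dvd_mult_iff)
    moreover have "0 \<le> \<mu>" "\<mu> < int p" by (simp_all add: \<mu>_def)
    ultimately have \<mu>\<Lambda>: "\<mu> \<in> \<Lambda>" by (cases "\<mu> = 0") (auto simp: \<Lambda>_def)
    have move: "[z = \<mu> * z'] (mod int p)" if z: "[z * inv_p u = z' * inv_p u'] (mod int p)" for z z'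
    proof -
      have "[z * 1 = z * (u * inv_p u)] (mod int p)"
        using inv_p_right[OF unit[OF u(1)]] by (intro cong_mult cong_refl) (rule cong_sym)
      hence "[z = u * (z * inv_p u)] (mod int p)" by (simp add: mult_ac)
      also have "[u * (z * inv_p u) = u * (z' * inv_p u')] (mod int p)" by (intro cong_mult cong_refl z)
      also have "u * (z' * inv_p u') = (u * inv_p u') * z'" by simp
      also have "[(u * inv_p u') * z' = \<mu> * z'] (mod int p)" by (intro cong_mult cong_refl cong_sym[OF \<mu>])
      finally show ?thesis .
    qed
    have "[a * (m - n) = a * (\<mu> * (m' - n'))] (mod int p)" using move[OF eq(1)] by (simp add: mult_ac)
    hence "(m, n, m', n') \<in> A \<mu>" using cong_cancel_left[OF a] M by (simp add: A_def)
    moreover have "[u = \<mu> * u'] (mod int p)"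
      using inv_p_right[OF unit[OF u(1)]] inv_p_right[OF unit[OF u(2)]]
      by (intro move) (meson cong_sym cong_trans)
    hence "(u, u') \<in> B \<mu>" using u by (simp add: B_def)
    moreover have "(k, k') \<in> D \<mu>" using move[OF eq(2)] k by (simp add: D_def)
    ultimately show "g z \<in> (\<Union>\<mu>\<in>\<Lambda>'. A \<mu> \<times> B \<mu> \<times> D \<mu>)"
      using \<mu>\<Lambda> by (auto simp: z g_def \<Lambda>'_def)
  qed
  ultimately have "card E \<le> card (\<Union>\<mu>\<in>\<Lambda>'. A \<mu> \<times> B \<mu> \<times> D \<mu>)"
    by (rule card_inj_on_le) (use fin_\<Lambda>' fin_A fin_B fin_D in auto)
  also have "\<dots> \<le> (\<Sum>\<mu>\<in>\<Lambda>'. card (A \<mu> \<times> B \<mu> \<times> D \<mu>))"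
    by (rule card_UN_le[OF fin_\<Lambda>'])
  finally have E: "real (card E) \<le> (\<Sum>\<mu>\<in>\<Lambda>'. real (card (A \<mu>)) * (real (card (B \<mu>)) * real (card (D \<mu>))))"
    by (simp add: card_cartesian_product flip: of_nat_mult of_nat_sum)

  \<comment> \<open>Choose a reduced fraction for each occurring ratio. Its denominator is a unit,
    so it determines \<mu> modulo \<open>p\<close>; a sum over ratios is thus at most one over all
    pairs in the box.\<close>
  have "\<forall>\<mu>\<in>\<Lambda>'. \<exists>c. coprime (fst c) (snd c) \<and> c \<in> {1..int U} \<times> {1..int U} \<and> [fst c = \<mu> * snd c] (mod int p)"
  proof
    fix \<mu> assume "\<mu> \<in> \<Lambda>'"
    then obtain u u' where u: "u \<in> {1..int U}" "u' \<in> {1..int U}" "[u = \<mu> * u'] (mod int p)"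
      by (auto simp: \<Lambda>'_def B_def)
    define d where "d = gcd u u'"
    have d: "d > 0" "d dvd u" "d dvd u'" using u by (auto simp: d_def)
    have "coprime (u div d) (u' div d)" using u unfolding d_def by (intro div_gcd_coprime) auto
    moreover have quot: "v div d \<in> {1..int U}" if "v \<in> {1..int U}" "d dvd v" for v
    proof -
      have "v div d > 0" using that d zdvd_imp_le[of d v] by (auto simp: pos_imp_zdiv_pos_iff)
      moreover have "v div d \<le> v" using that d zdiv_mono2[of v 1 d] by auto
      ultimately show ?thesis using that by auto
    qed
    moreover have "[u div d = \<mu> * (u' div d)] (mod int p)"
    proof (rule cong_cancel_left[of d])
      show "\<not> int p dvd d" using d(2) unit[OF u(1)] dvd_trans by blast
      show "[d * (u div d) = d * (\<mu> * (u' div d))] (mod int p)" using u(3) d by (simp add: mult.left_commute)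
    qed
    ultimately show "\<exists>c. coprime (fst c) (snd c) \<and> c \<in> {1..int U} \<times> {1..int U} \<and> [fst c = \<mu> * snd c] (mod int p)"
      using u d by (intro exI[of _ "(u div d, u' div d)"]) auto
  qed
  from bchoice[OF this] obtain c where c: "\<And>\<mu>. \<mu> \<in> \<Lambda>' \<Longrightarrow> coprime (fst (c \<mu>)) (snd (c \<mu>))"
      "\<And>\<mu>. \<mu> \<in> \<Lambda>' \<Longrightarrow> c \<mu> \<in> {1..int U} \<times> {1..int U}"
      "\<And>\<mu>. \<mu> \<in> \<Lambda>' \<Longrightarrow> [fst (c \<mu>) = \<mu> * snd (c \<mu>)] (mod int p)" by blast
  define h :: "int \<times> int \<Rightarrow> real" where "h = (\<lambda>(x, y). 1 / (real_of_int x * real_of_int y))"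

  have inj_c: "inj_on c \<Lambda>'"
  proof (rule inj_onI)
    fix \<mu> \<mu>' assume *: "\<mu> \<in> \<Lambda>'" "\<mu>' \<in> \<Lambda>'" "c \<mu> = c \<mu>'"
    have "[snd (c \<mu>) * \<mu> = snd (c \<mu>) * \<mu>'] (mod int p)"
      using c(3)[OF *(1)] c(3)[OF *(2)] *(3) by (metis cong_sym cong_trans mult.commute)
    moreover have "\<not> int p dvd snd (c \<mu>)" using c(2)[OF *(1)] by (intro unit) auto
    ultimately have "[\<mu> = \<mu>'] (mod int p)" by (rule cong_cancel_left[rotated])
    thus "\<mu> = \<mu>'" using * by (intro cong_Fp_imp_eq) (auto simp: \<Lambda>'_def \<Lambda>_def Fp_def)
  qed
  have harm: "(\<Sum>x\<in>{1..int U}. 1 / real_of_int x) = harm U"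
    unfolding harm_def
    by (rule sum.reindex_bij_witness[of _ int nat]) (auto simp: inverse_eq_divide)
  have sum_h: "(\<Sum>\<mu>\<in>\<Lambda>'. h (c \<mu>)) \<le> (harm U)\<^sup>2"
  proof -
    have "(\<Sum>\<mu>\<in>\<Lambda>'. h (c \<mu>)) = (\<Sum>z\<in>c ` \<Lambda>'. h z)" by (simp add: sum.reindex[OF inj_c])
    also have "\<dots> \<le> (\<Sum>z\<in>{1..int U} \<times> {1..int U}. h z)"
    proof (rule sum_mono2)
      show "c ` \<Lambda>' \<subseteq> {1..int U} \<times> {1..int U}" using c(2) by blast
    qed (auto simp: h_def)
    also have "\<dots> = (harm U)\<^sup>2"
      unfolding harm[symmetric] power2_eq_square sum_product
      by (simp add: h_def sum.cartesian_product case_prod_unfold)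
    finally show ?thesis .
  qed

  \<comment> \<open>Once \<mu>, \<open>n\<close>, \<open>m'\<close> and \<open>n'\<close> are
    chosen, \<open>m\<close> is determined.\<close>
  have A3: "real (card (A \<mu>)) \<le> real (card \<M>) ^ 3" for \<mu>
  proof -
    have "inj_on (\<lambda>(m, n, m', n'). (n, m', n')) (A \<mu>)"
    proof (rule inj_onI, clarsimp simp: A_def)
      fix m1 m2 n m' n' assume "m1 \<in> \<M>" "m2 \<in> \<M>" "[m1 - n = \<mu> * (m' - n')] (mod int p)"
        "[m2 - n = \<mu> * (m' - n')] (mod int p)"
      hence "[m1 - n = m2 - n] (mod int p)" by (meson cong_sym cong_trans)
      hence "[m1 = m2] (mod int p)" by (simp add: cong_iff_dvd_diff)
      thus "m1 = m2" using \<open>m1 \<in> \<M>\<close> \<open>m2 \<in> \<M>\<close> \<M> by (intro cong_Fp_imp_eq) auto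
    qed
    moreover have "(\<lambda>(m, n, m', n'). (n, m', n')) ` A \<mu> \<subseteq> \<M> \<times> \<M> \<times> \<M>" by (auto simp: A_def)
    ultimately have "card (A \<mu>) \<le> card (\<M> \<times> \<M> \<times> \<M>)"
      by (rule card_inj_on_le) (use fin_\<M> in auto)
    hence "real (card (A \<mu>)) \<le> real (card (\<M> \<times> \<M> \<times> \<M>))" by (rule of_nat_mono)
    thus ?thesis by (simp add: card_cartesian_product power3_eq_cube)
  qed
  have A4: "(\<Sum>\<mu>\<in>\<Lambda>'. real (card (A \<mu>))) \<le> real (card \<M>) ^ 4"
  proof -
    \<comment> \<open>Since m' - n' is a unit, a quadruple determines its ratio, so the sets for
      different \<mu> share the M^4 quadruples.\<close>
    have "disjoint_family_on A \<Lambda>'"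
      unfolding disjoint_family_on_def
    proof (intro ballI impI equals0I)
      fix \<mu> \<mu>' z assume *: "\<mu> \<in> \<Lambda>'" "\<mu>' \<in> \<Lambda>'" "\<mu> \<noteq> \<mu>'" "z \<in> A \<mu> \<inter> A \<mu>'"
      then obtain m n m' n' where z: "m' \<in> \<M>" "n' \<in> \<M>" "m' \<noteq> n'"
          "[m - n = \<mu> * (m' - n')] (mod int p)" "[m - n = \<mu>' * (m' - n')] (mod int p)"
        by (auto simp: A_def)
      have "\<not> int p dvd m' - n'"
        using z \<M> cong_Fp_imp_eq[of m' n'] by (auto simp: cong_iff_dvd_diff)
      moreover have "[(m' - n') * \<mu> = (m' - n') * \<mu>'] (mod int p)"
        using z(4,5) by (metis cong_sym cong_trans mult.commute)
      ultimately have "[\<mu> = \<mu>'] (mod int p)" by (rule cong_cancel_left)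
      thus False using * cong_Fp_imp_eq[of \<mu> \<mu>'] by (auto simp: \<Lambda>'_def \<Lambda>_def Fp_def)
    qed
    hence "(\<Sum>\<mu>\<in>\<Lambda>'. card (A \<mu>)) = card (\<Union>\<mu>\<in>\<Lambda>'. A \<mu>)"
      using fin_\<Lambda>' fin_A by (simp add: card_UN_disjoint' disjoint_family_on_def card_UN_disjoint)
    also have "\<dots> \<le> card (\<M> \<times> \<M> \<times> \<M> \<times> \<M>)" by (intro card_mono) (auto simp: A_def fin_\<M>)
    finally have "real (\<Sum>\<mu>\<in>\<Lambda>'. card (A \<mu>)) \<le> real (card (\<M> \<times> \<M> \<times> \<M> \<times> \<M>))" by (rule of_nat_mono)
    thus ?thesis by (simp add: card_cartesian_product power4_eq_xxxx mult.assoc)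
  qed

  define q where "q = (real L)\<^sup>2 / (real p)\<^sup>2"
  have "real (card E) \<le> (\<Sum>\<mu>\<in>\<Lambda>'. real (card (A \<mu>)) * (32 * real U * real L * (h (c \<mu>) + q)))"
  proof (rule order.trans[OF E], intro sum_mono mult_left_mono)
    fix \<mu> assume "\<mu> \<in> \<Lambda>'"
    thus "real (card (B \<mu>)) * real (card (D \<mu>)) \<le> 32 * real U * real L * (h (c \<mu>) + q)"
      unfolding B_def D_def h_def case_prod_unfold q_def
      using c[of \<mu>] U ratio_pair_count[of "fst (c \<mu>)" "snd (c \<mu>)" U \<mu> L X]
      by (auto simp: mem_Times_iff case_prod_unfold)
  qed auto
  also have "\<dots> = 32 * real U * real L *
      ((\<Sum>\<mu>\<in>\<Lambda>'. real (card (A \<mu>)) * h (c \<mu>)) + (\<Sum>\<mu>\<in>\<Lambda>'. real (card (A \<mu>))) * q)"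
    by (simp add: sum_distrib_left sum_distrib_right sum.distrib[symmetric] algebra_simps)
  also have "\<dots> \<le> 32 * real U * real L * (real (card \<M>) ^ 3 * (harm U)\<^sup>2 + real (card \<M>) ^ 4 * q)"
  proof (intro mult_left_mono add_mono mult_right_mono A4)
    have "(\<Sum>\<mu>\<in>\<Lambda>'. real (card (A \<mu>)) * h (c \<mu>)) \<le> (\<Sum>\<mu>\<in>\<Lambda>'. real (card \<M>) ^ 3 * h (c \<mu>))"
      using c(2) by (intro sum_mono mult_right_mono A3) (force simp: h_def case_prod_unfold)
    also have "\<dots> \<le> real (card \<M>) ^ 3 * (harm U)\<^sup>2"
      unfolding sum_distrib_left[symmetric] by (intro mult_left_mono sum_h) auto
    finally show "(\<Sum>\<mu>\<in>\<Lambda>'. real (card (A \<mu>)) * h (c \<mu>)) \<le> real (card \<M>) ^ 3 * (harm U)\<^sup>2" .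
  qed (auto simp: q_def)
  finally show ?thesis by (simp add: E_def q_def)
qed

end

section \<open>The shift argument\<close>

context prime_modulus
begin

text \<open>The family \<kappa> is arbitrary so that one expansion serves both majorants, with
  \<kappa> equal to k + u v in one and to a difference i - j in the other. The weights are bounded
  only after opening the square; each diagonal pair contributes at most
  \<open>card J\<close>.\<close>

lemma bilinear_square_expand:
  fixes \<alpha> :: "int \<Rightarrow> complex" and \<kappa> :: "'j \<Rightarrow> int"
  assumes fin: "finite \<M>" and \<alpha>: "\<And>m. m \<in> \<M> \<Longrightarrow> cmod (\<alpha> m) \<le> A"
  shows "(\<Sum>j\<in>J. (cmod (\<Sum>m\<in>\<M>. \<alpha> m * inv_char (a * m) (\<kappa> j)))\<^sup>2)
    \<le> A\<^sup>2 * (real (card \<M>) * real (card J)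
        + (\<Sum>(m, n)\<in>{(m, n). m \<in> \<M> \<and> n \<in> \<M> \<and> m \<noteq> n}. cmod (\<Sum>j\<in>J. inv_char (a * (m - n)) (\<kappa> j))))"
proof -
  define c where "c = (\<lambda>m n. cmod (\<Sum>j\<in>J. inv_char (a * (m - n)) (\<kappa> j)))"
  have "complex_of_real (\<Sum>j\<in>J. (cmod (\<Sum>m\<in>\<M>. \<alpha> m * inv_char (a * m) (\<kappa> j)))\<^sup>2)
      = (\<Sum>j\<in>J. \<Sum>m\<in>\<M>. \<Sum>n\<in>\<M>. \<alpha> m * cnj (\<alpha> n) * inv_char (a * (m - n)) (\<kappa> j))"
    unfolding of_real_sum complex_norm_square cnj_sum sum_product right_diff_distrib
      inv_char_mult_cnj[symmetric]
    by (intro sum.cong refl) (simp add: mult_ac)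
  also have "\<dots> = (\<Sum>m\<in>\<M>. \<Sum>j\<in>J. \<Sum>n\<in>\<M>. \<alpha> m * cnj (\<alpha> n) * inv_char (a * (m - n)) (\<kappa> j))"
    by (rule sum.swap)
  also have "\<dots> = (\<Sum>m\<in>\<M>. \<Sum>n\<in>\<M>. \<alpha> m * cnj (\<alpha> n) * (\<Sum>j\<in>J. inv_char (a * (m - n)) (\<kappa> j)))"
    unfolding sum_distrib_left by (intro sum.cong refl sum.swap)
  finally have eq: "complex_of_real (\<Sum>j\<in>J. (cmod (\<Sum>m\<in>\<M>. \<alpha> m * inv_char (a * m) (\<kappa> j)))\<^sup>2)
      = (\<Sum>m\<in>\<M>. \<Sum>n\<in>\<M>. \<alpha> m * cnj (\<alpha> n) * (\<Sum>j\<in>J. inv_char (a * (m - n)) (\<kappa> j)))" .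
  have "(\<Sum>j\<in>J. (cmod (\<Sum>m\<in>\<M>. \<alpha> m * inv_char (a * m) (\<kappa> j)))\<^sup>2)
      = cmod (complex_of_real (\<Sum>j\<in>J. (cmod (\<Sum>m\<in>\<M>. \<alpha> m * inv_char (a * m) (\<kappa> j)))\<^sup>2))"
    unfolding norm_of_real by (rule abs_of_nonneg[symmetric]) (intro sum_nonneg zero_le_power2)
  also have "\<dots> \<le> (\<Sum>m\<in>\<M>. \<Sum>n\<in>\<M>. A\<^sup>2 * c m n)"
    unfolding eq
  proof (intro sum_norm_le)
    fix m n assume mn: "m \<in> \<M>" "n \<in> \<M>"
    have "cmod (\<alpha> m) * cmod (\<alpha> n) \<le> A * A"
      using \<alpha>[OF mn(1)] \<alpha>[OF mn(2)] by (intro mult_mono) (auto intro: order.trans[OF norm_ge_zero])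
    thus "cmod (\<alpha> m * cnj (\<alpha> n) * (\<Sum>j\<in>J. inv_char (a * (m - n)) (\<kappa> j))) \<le> A\<^sup>2 * c m n"
      unfolding c_def norm_mult complex_mod_cnj power2_eq_square by (intro mult_right_mono) auto
  qed
  also have "\<dots> = A\<^sup>2 * (\<Sum>(m, n)\<in>\<M> \<times> \<M>. c m n)"
    by (simp add: sum.cartesian_product sum_distrib_left case_prod_unfold)
  also have "(\<Sum>(m, n)\<in>\<M> \<times> \<M>. c m n)
      = (\<Sum>(m, n)\<in>(\<lambda>m. (m, m)) ` \<M>. c m n) + (\<Sum>(m, n)\<in>{(m, n). m \<in> \<M> \<and> n \<in> \<M> \<and> m \<noteq> n}. c m n)"
    using fin by (subst sum.union_disjoint[symmetric])
      (auto intro!: sum.cong intro: finite_subset[of _ "\<M> \<times> \<M>"])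
  also have "(\<Sum>(m, n)\<in>(\<lambda>m. (m, m)) ` \<M>. c m n) = (\<Sum>m\<in>\<M>. c m m)"
    by (subst sum.reindex) (auto simp: inj_on_def)
  also have "\<dots> \<le> real (card \<M>) * real (card J)"
  proof (rule sum_bounded_above)
    fix m
    have "c m m \<le> (\<Sum>j\<in>J. 1)" unfolding c_def by (intro sum_norm_le norm_inv_char_le)
    thus "c m m \<le> real (card J)" by simp
  qed
  finally show ?thesis by (simp add: c_def mult_left_mono)
qed

text \<open>Since the summands are non-negative, averaging over the shifts \<open>u * v\<close> loses only a constant.\<close>

lemma interval_shift_le:
  fixes F :: "int \<Rightarrow> real"
  assumes F: "\<And>k. F k \<ge> 0" and UV: "U * V \<le> K"
  shows "real (U * V) * (\<Sum>k\<in>{K0 + 1..K0 + int K}. F k)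
    \<le> (\<Sum>(u, k, v)\<in>{1..int U} \<times> {(K0 - int K) + 1..(K0 - int K) + int (2 * K)} \<times> {1..int V}. F (k + u * v))"
proof -
  define I where "I = {(K0 - int K) + 1..(K0 - int K) + int (2 * K)}"
  have "real (U * V) * (\<Sum>k\<in>{K0 + 1..K0 + int K}. F k)
      = (\<Sum>u\<in>{1..int U}. \<Sum>v\<in>{1..int V}. \<Sum>k\<in>{K0 + 1..K0 + int K}. F k)"
    by simp
  also have "\<dots> \<le> (\<Sum>u\<in>{1..int U}. \<Sum>v\<in>{1..int V}. \<Sum>k\<in>I. F (k + u * v))"
  proof (intro sum_mono)
    fix u v assume uv: "u \<in> {1..int U}" "v \<in> {1..int V}"
    have "u * v \<le> int U * int V" using uv by (intro mult_mono) auto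
    moreover have "int U * int V \<le> int K" using UV by (simp flip: of_nat_mult)
    ultimately have "0 \<le> u * v" "u * v \<le> int K" using uv by auto
    \<comment> \<open>Shifts lie between 0 and \<open>K\<close>, so extending the interval by
      \<open>K\<close> to the left covers every k - u v.\<close>
    hence "{K0 + 1..K0 + int K} \<subseteq> (\<lambda>k. k + u * v) ` I"
      by (auto simp: I_def image_iff intro!: bexI[of _ "k - u * v" for k])
    hence "(\<Sum>k\<in>{K0 + 1..K0 + int K}. F k) \<le> (\<Sum>k\<in>(\<lambda>k. k + u * v) ` I. F k)"
      using F by (intro sum_mono2) (auto simp: I_def)
    also have "\<dots> = (\<Sum>k\<in>I. F (k + u * v))"
      by (subst sum.reindex) (auto simp: inj_on_def)
    finally show "(\<Sum>k\<in>{K0 + 1..K0 + int K}. F k) \<le> (\<Sum>k\<in>I. F (k + u * v))" .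
  qed
  also have "\<dots> = (\<Sum>u\<in>{1..int U}. \<Sum>k\<in>I. \<Sum>v\<in>{1..int V}. F (k + u * v))"
    by (intro sum.cong refl sum.swap)
  finally show ?thesis by (simp add: sum.cartesian_product I_def)
qed

text \<open>The witness \<open>D\<close> sums, over off-diagonal (m, n) and all (u, k), the moduli
  of the inner sums over \<open>v\<close>. Its 2r-th power is bounded by a point count, a count of
  coincidences and a moment. Stating the bound for the power postpones all roots to the final
  comparison.\<close>

lemma interval_mean_square_shift:
  fixes \<alpha> :: "int \<Rightarrow> complex" and \<M> :: "int set" and U V K n :: nat and K0 a :: int
  defines "M \<equiv> real (card \<M>)"
  assumes \<M>: "\<M> \<subseteq> Fp p" and \<alpha>: "\<And>m. m \<in> \<M> \<Longrightarrow> cmod (\<alpha> m) \<le> A" and a: "\<not> int p dvd a"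
    and r: "Suc n < p" and U: "0 < U" "U < p" and V: "0 < V" "V < p" and K: "U * V \<le> K"
  shows "\<exists>D\<ge>0. D ^ (2 * Suc n) \<le> (M\<^sup>2 * real U * (2 * real K)) ^ (2 * n)
      * (32 * real U * (2 * real K) * (M ^ 3 * (harm U)\<^sup>2 + M ^ 4 * (2 * real K)\<^sup>2 / (real p)\<^sup>2))
      * (real p * (real (Suc n) ^ Suc n * real V ^ Suc n * real p + 2 * real (Suc n) * real V ^ (2 * Suc n)))
    \<and> (\<Sum>k\<in>{K0 + 1..K0 + int K}. (cmod (\<Sum>m\<in>\<M>. \<alpha> m * inv_char (a * m) k))\<^sup>2)
      \<le> A\<^sup>2 * (2 * M * real K + D / (real U * real V))"
proof -
  define I where "I = {(K0 - int K) + 1..(K0 - int K) + int (2 * K)}"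
  define J where "J = {1..int U} \<times> I \<times> {1..int V}"
  define Off where "Off = {(m, n). m \<in> \<M> \<and> n \<in> \<M> \<and> m \<noteq> n}"
  define \<Omega> where "\<Omega> = {(m, n, u, k). m \<in> \<M> \<and> n \<in> \<M> \<and> m \<noteq> n \<and> u \<in> {1..int U} \<and> k \<in> I}"
  define f where "f = (\<lambda>(m, n, u, k). (a * (m - n) * inv_p u mod int p, k * inv_p u mod int p))"
  define G where "G = (\<lambda>(x, y). cmod (\<Sum>v\<in>{1..int V}. inv_char x (y + v)))"
  define \<nu> where "\<nu> = (\<lambda>z. real (card {\<omega> \<in> \<Omega>. f \<omega> = z}))"
  define Z where "Z = Fp p \<times> Fp p"
  define D where "D = (\<Sum>\<omega>\<in>\<Omega>. G (f \<omega>))"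
  have fin_\<M>: "finite \<M>" using \<M> finite_Fp finite_subset by blast
  have fin_\<Omega>: "finite \<Omega>"
    by (rule finite_subset[of _ "\<M> \<times> \<M> \<times> {1..int U} \<times> I"]) (auto simp: \<Omega>_def I_def fin_\<M>)
  have fin_Z: "finite Z" by (simp add: Z_def)
  have f_Z: "f ` \<Omega> \<subseteq> Z" by (auto simp: f_def Z_def Fp_def)
  have unit: "\<not> int p dvd u" if "u \<in> {1..int U}" for u
    using that U zdvd_not_zless[of u "int p"] by auto
  have G0: "G z \<ge> 0" for z by (simp add: G_def case_prod_unfold)
  have D0: "D \<ge> 0" unfolding D_def by (intro sum_nonneg G0)
  have D: "D = (\<Sum>z\<in>Z. \<nu> z * G z)"
    unfolding D_def \<nu>_def by (rule sum_comp_fibres[OF fin_\<Omega> fin_Z f_Z])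

  have "D ^ (2 * Suc n) \<le> (\<Sum>z\<in>Z. \<nu> z) ^ (2 * n) * (\<Sum>z\<in>Z. (\<nu> z)\<^sup>2) * (\<Sum>z\<in>Z. G z ^ (2 * Suc n))"
    unfolding D by (rule holder_energy) (simp_all add: \<nu>_def G0)
  also have "\<dots> \<le> (M\<^sup>2 * real U * (2 * real K)) ^ (2 * n)
      * (32 * real U * (2 * real K) * (M ^ 3 * (harm U)\<^sup>2 + M ^ 4 * (2 * real K)\<^sup>2 / (real p)\<^sup>2))
      * (real p * (real (Suc n) ^ Suc n * real V ^ Suc n * real p + 2 * real (Suc n) * real V ^ (2 * Suc n)))"
  proof (intro mult_mono power_mono)
    have "(\<Sum>z\<in>Z. \<nu> z) = real (card \<Omega>)"
      using sum_comp_fibres[OF fin_\<Omega> fin_Z f_Z, of "\<lambda>_. 1"] by (simp add: \<nu>_def)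
    also have "card \<Omega> \<le> card (\<M> \<times> \<M> \<times> {1..int U} \<times> I)"
      by (rule card_mono) (auto simp: \<Omega>_def I_def fin_\<M>)
    also have "real (card (\<M> \<times> \<M> \<times> {1..int U} \<times> I)) = M\<^sup>2 * real U * (2 * real K)"
      by (simp add: card_cartesian_product I_def M_def power2_eq_square)
    finally show "(\<Sum>z\<in>Z. \<nu> z) \<le> M\<^sup>2 * real U * (2 * real K)" by simp
  next
    have "U * 1 \<le> U * V" using V by (intro mult_left_mono) auto
    hence "U \<le> 2 * K" using K by linarith
    hence "real (card {(\<omega>, \<omega>'). \<omega> \<in> \<Omega> \<and> \<omega>' \<in> \<Omega> \<and> f \<omega> = f \<omega>'})
      \<le> 32 * real U * real (2 * K) * (M ^ 3 * (harm U)\<^sup>2 + M ^ 4 * (real (2 * K))\<^sup>2 / (real p)\<^sup>2)"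
      unfolding \<Omega>_def f_def I_def M_def by (intro ratio_energy_bound a \<M> U)
    thus "(\<Sum>z\<in>Z. (\<nu> z)\<^sup>2)
        \<le> 32 * real U * (2 * real K) * (M ^ 3 * (harm U)\<^sup>2 + M ^ 4 * (2 * real K)\<^sup>2 / (real p)\<^sup>2)"
      unfolding \<nu>_def sum_card_fibres_squared[OF fin_\<Omega> fin_Z f_Z] by simp
  next
    show "(\<Sum>z\<in>Z. G z ^ (2 * Suc n))
      \<le> real p * (real (Suc n) ^ Suc n * real V ^ Suc n * real p + 2 * real (Suc n) * real V ^ (2 * Suc n))"
      using inv_char_moment[OF V(2) zero_less_Suc r]
      unfolding Z_def G_def sum.cartesian_product by (simp only: case_prod_unfold)
  qed (auto intro!: sum_nonneg mult_nonneg_nonneg simp: \<nu>_def G0 M_def)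
  finally have D_le: "D ^ (2 * Suc n) \<le> (M\<^sup>2 * real U * (2 * real K)) ^ (2 * n)
      * (32 * real U * (2 * real K) * (M ^ 3 * (harm U)\<^sup>2 + M ^ 4 * (2 * real K)\<^sup>2 / (real p)\<^sup>2))
      * (real p * (real (Suc n) ^ Suc n * real V ^ Suc n * real p + 2 * real (Suc n) * real V ^ (2 * Suc n)))" .

  have "(\<Sum>(m, n)\<in>Off. cmod (\<Sum>(u, k, v)\<in>J. inv_char (a * (m - n)) (k + u * v)))
      \<le> (\<Sum>(m, n)\<in>Off. \<Sum>(u, k)\<in>{1..int U} \<times> I. G (f (m, n, u, k)))"
  proof (intro sum_mono, clarify)
    fix m n :: int
    have "(\<Sum>(u, k, v)\<in>J. inv_char (a * (m - n)) (k + u * v))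
        = (\<Sum>u\<in>{1..int U}. \<Sum>k\<in>I. \<Sum>v\<in>{1..int V}. inv_char (a * (m - n)) (k + u * v))"
      by (simp add: J_def sum.cartesian_product)
    also have "cmod \<dots> \<le> (\<Sum>u\<in>{1..int U}. \<Sum>k\<in>I. G (f (m, n, u, k)))"
    proof (intro sum_norm_le)
      fix u k assume u: "u \<in> {1..int U}"
      show "cmod (\<Sum>v\<in>{1..int V}. inv_char (a * (m - n)) (k + u * v)) \<le> G (f (m, n, u, k))"
        by (simp add: G_def f_def inv_char_dilate[OF unit[OF u]])
    qed
    finally show "cmod (\<Sum>(u, k, v)\<in>J. inv_char (a * (m - n)) (k + u * v))
        \<le> (\<Sum>(u, k)\<in>{1..int U} \<times> I. G (f (m, n, u, k)))"
      by (simp add: sum.cartesian_product)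
  qed
  also have "\<dots> = D"
    unfolding D_def sum.cartesian_product case_prod_unfold
    by (rule sum.reindex_bij_witness[of _ "\<lambda>(m, n, u, k). ((m, n), (u, k))" "\<lambda>((m, n), (u, k)). (m, n, u, k)"])
       (auto simp: \<Omega>_def Off_def)
  finally have off: "(\<Sum>(m, n)\<in>Off. cmod (\<Sum>(u, k, v)\<in>J. inv_char (a * (m - n)) (k + u * v))) \<le> D" .

  define F where "F = (\<lambda>k. (cmod (\<Sum>m\<in>\<M>. \<alpha> m * inv_char (a * m) k))\<^sup>2)"
  have "real (U * V) * (\<Sum>k\<in>{K0 + 1..K0 + int K}. F k) \<le> (\<Sum>(u, k, v)\<in>J. F (k + u * v))"
    unfolding J_def I_def by (rule interval_shift_le[OF _ K]) (simp add: F_def)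
  also have "\<dots> \<le> A\<^sup>2 * (M * real (card J)
      + (\<Sum>(m, n)\<in>Off. cmod (\<Sum>(u, k, v)\<in>J. inv_char (a * (m - n)) (k + u * v))))"
    unfolding M_def Off_def F_def
    using bilinear_square_expand[OF fin_\<M> \<alpha>, where a = a and \<kappa> = "\<lambda>(u, k, v). k + u * v" and J = J]
    by (simp only: case_prod_unfold)
  also have "\<dots> \<le> A\<^sup>2 * (M * real (card J) + D)"
    by (intro mult_left_mono add_mono off) (auto simp: M_def)
  also have "real (card J) = 2 * real (U * V) * real K"
    by (simp add: J_def I_def card_cartesian_product)
  finally have "(\<Sum>k\<in>{K0 + 1..K0 + int K}. F k) \<le> A\<^sup>2 * (M * (2 * real (U * V) * real K) + D) / real (U * V)"
    using U V by (subst pos_le_divide_eq) (simp_all add: mult.commute)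
  also have "\<dots> = A\<^sup>2 * (2 * M * real K + D / (real U * real V))"
    using U V by (simp add: field_simps)
  finally show ?thesis
    using D_le D0 unfolding F_def by blast
qed

end

section \<open>Kloosterman sums on average\<close>

context prime_modulus
begin

definition kloosterman :: "int \<Rightarrow> int \<Rightarrow> complex" where
  "kloosterman d h = (\<Sum>k\<in>{1..<int p}. e_mod p (d * inv_p k + h * k))"

lemma unit_not_dvd: "k \<in> {1..<int p} \<Longrightarrow> \<not> int p dvd k"
  using zdvd_not_zless[of k "int p"] by auto

lemma nat_p_minus_1 [simp]: "nat (int p - 1) = p - 1"
  by simp

lemma unit_cong_imp_eq:
  assumes "x \<in> {1..<int p}" "y \<in> {1..<int p}" "[x = y] (mod int p)"
  shows "x = y"
  using assms by (intro cong_Fp_imp_eq) (auto simp: Fp_def)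

text \<open>Clearing denominators gives (k1 + k2) k3 k4 = (k1 + k2) k1 k2. Either k1 + k2 vanishes,
  and so does k3 + k4, or the two pairs have equal sum and product and agree up to order. Each of
  the three resulting families has two free parameters.\<close>

lemma kloosterman_quadruples:
  "card {(k1, k2, k3, k4). k1 \<in> {1..<int p} \<and> k2 \<in> {1..<int p} \<and> k3 \<in> {1..<int p} \<and> k4 \<in> {1..<int p}
      \<and> int p dvd inv_p k1 + inv_p k2 - inv_p k3 - inv_p k4 \<and> int p dvd k1 + k2 - k3 - k4}
    \<le> 3 * p\<^sup>2"
proof -
  define Q where "Q = {(k1, k2, k3, k4). k1 \<in> {1..<int p} \<and> k2 \<in> {1..<int p} \<and> k3 \<in> {1..<int p} \<and> k4 \<in> {1..<int p}
      \<and> int p dvd inv_p k1 + inv_p k2 - inv_p k3 - inv_p k4 \<and> int p dvd k1 + k2 - k3 - k4}"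
  define W where "W = {1..<int p} \<times> {1..<int p}"
  define f1 :: "int \<times> int \<Rightarrow> int \<times> int \<times> int \<times> int" where "f1 = (\<lambda>(x, y). (x, y, x, y))"
  define f2 :: "int \<times> int \<Rightarrow> int \<times> int \<times> int \<times> int" where "f2 = (\<lambda>(x, y). (x, y, y, x))"
  define f3 :: "int \<times> int \<Rightarrow> int \<times> int \<times> int \<times> int" where "f3 = (\<lambda>(x, y). (x, int p - x, y, int p - y))"
  have "Q \<subseteq> f1 ` W \<union> f2 ` W \<union> f3 ` W"
  proof
    fix z assume "z \<in> Q"
    moreover obtain k1 k2 k3 k4 where z: "z = (k1, k2, k3, k4)" by (metis prod.collapse)
    ultimately have k: "k1 \<in> {1..<int p}" "k2 \<in> {1..<int p}" "k3 \<in> {1..<int p}" "k4 \<in> {1..<int p}"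
      and T: "[inv_p k1 + inv_p k2 = inv_p k3 + inv_p k4] (mod int p)"
      and S: "[k1 + k2 = k3 + k4] (mod int p)"
      by (auto simp: Q_def cong_iff_dvd_diff algebra_simps)
    note kk = inv_p_right[OF unit_not_dvd[OF k(1)]] inv_p_right[OF unit_not_dvd[OF k(2)]]
      inv_p_right[OF unit_not_dvd[OF k(3)]] inv_p_right[OF unit_not_dvd[OF k(4)]]
    have lhs: "[(k1 * k2 * k3 * k4) * (inv_p k1 + inv_p k2) = (k1 + k2) * (k3 * k4)] (mod int p)"
    proof -
      have "[(k1 * inv_p k1) * (k2 * k3 * k4) + (k2 * inv_p k2) * (k1 * k3 * k4)
          = 1 * (k2 * k3 * k4) + 1 * (k1 * k3 * k4)] (mod int p)"
        by (intro cong_add cong_mult cong_refl kk)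
      thus ?thesis by (simp add: algebra_simps)
    qed
    have rhs: "[(k1 * k2 * k3 * k4) * (inv_p k3 + inv_p k4) = (k3 + k4) * (k1 * k2)] (mod int p)"
    proof -
      have "[(k3 * inv_p k3) * (k1 * k2 * k4) + (k4 * inv_p k4) * (k1 * k2 * k3)
          = 1 * (k1 * k2 * k4) + 1 * (k1 * k2 * k3)] (mod int p)"
        by (intro cong_add cong_mult cong_refl kk)
      thus ?thesis by (simp add: algebra_simps)
    qed
    have "[(k1 + k2) * (k3 * k4) = (k3 + k4) * (k1 * k2)] (mod int p)"
      using cong_trans[OF cong_trans[OF cong_sym[OF lhs] cong_mult[OF cong_refl T]] rhs] .
    also have "[(k3 + k4) * (k1 * k2) = (k1 + k2) * (k1 * k2)] (mod int p)"
      by (intro cong_mult cong_refl cong_sym[OF S])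
    finally have main: "[(k1 + k2) * (k3 * k4) = (k1 + k2) * (k1 * k2)] (mod int p)" .
    have sum_p: "y = int p - x" if "x \<in> {1..<int p}" "y \<in> {1..<int p}" "int p dvd x + y" for x y
    proof -
      obtain c where c: "x + y = int p * c" using \<open>int p dvd x + y\<close> by (auto simp: dvd_def)
      have l1: "int p * 0 < int p * c" using that c by simp
      have l2: "int p * c < int p * 2" using that(1,2) unfolding c[symmetric] by (simp only: atLeastLessThan_iff) linarith
      have "c = 1" using mult_left_less_imp_less[OF l1] mult_left_less_imp_less[OF l2] by simp
      thus ?thesis using c by simp
    qed
    show "z \<in> f1 ` W \<union> f2 ` W \<union> f3 ` W"
    proof (cases "int p dvd k1 + k2")
      case True
      moreover from this S have "int p dvd k3 + k4" by (simp add: cong_dvd_iff)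
      ultimately have "z = f3 (k1, k3)" using k by (simp add: z f3_def sum_p)
      thus ?thesis using k by (auto simp: W_def)
    next
      case False
      have prod: "[k3 * k4 = k1 * k2] (mod int p)" by (rule cong_cancel_left[OF False main])
      \<comment> \<open>Equal sum and product make \<open>k3\<close> a root of the quadratic with
        roots \<open>k1\<close> and \<open>k2\<close>.\<close>
      have "[(k3 - k1) * (k3 - k2) = 0] (mod int p)"
      proof -
        have "(k3 - k1) * (k3 - k2) = k3 * k3 - k3 * (k1 + k2) + k1 * k2" by (simp add: algebra_simps)
        also have "[\<dots> = k3 * k3 - k3 * (k3 + k4) + k3 * k4] (mod int p)"
          by (intro cong_add cong_diff cong_mult cong_refl S cong_sym[OF prod])
        also have "k3 * k3 - k3 * (k3 + k4) + k3 * k4 = 0" by (simp add: algebra_simps)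
        finally show ?thesis .
      qed
      hence "int p dvd k3 - k1 \<or> int p dvd k3 - k2"
        using prime_int_p by (simp add: cong_0_iff prime_dvd_mult_iff)
      thus ?thesis
      proof
        assume "int p dvd k3 - k1"
        hence "k3 = k1" using k by (intro unit_cong_imp_eq) (simp_all add: cong_iff_dvd_diff)
        moreover from this S have "k4 = k2"
          using k by (intro unit_cong_imp_eq) (simp_all add: cong_iff_dvd_diff dvd_diff_commute)
        ultimately have "z = f1 (k1, k2)" by (simp add: z f1_def)
        thus ?thesis using k by (auto simp: W_def)
      next
        assume "int p dvd k3 - k2"
        hence "k3 = k2" using k by (intro unit_cong_imp_eq) (simp_all add: cong_iff_dvd_diff)
        moreover from this S have "k4 = k1"
          using k by (intro unit_cong_imp_eq) (simp_all add: cong_iff_dvd_diff dvd_diff_commute)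
        ultimately have "z = f2 (k1, k2)" by (simp add: z f2_def)
        thus ?thesis using k by (auto simp: W_def)
      qed
    qed
  qed
  hence "card Q \<le> card (f1 ` W \<union> f2 ` W \<union> f3 ` W)" by (rule card_mono[rotated]) (simp add: W_def)
  also have "\<dots> \<le> card (f1 ` W) + card (f2 ` W) + card (f3 ` W)"
    by (meson add_le_mono card_Un_le le_refl order.trans)
  also have "\<dots> \<le> card W + card W + card W"
    by (intro add_mono card_image_le) (simp_all add: W_def)
  also have "\<dots> = 3 * (p - 1)\<^sup>2" by (simp add: W_def card_cartesian_product power2_eq_square)
  also have "\<dots> \<le> 3 * p\<^sup>2" by (intro mult_left_mono power_mono) auto
  finally show ?thesis by (simp add: Q_def)
qed

text \<open>Orthogonality in \<open>d\<close> and in \<open>h\<close> each contributes a factor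
  \<open>p\<close> and one of the two conditions on quadruples, of which at most 3 p^2
  remain.\<close>

lemma kloosterman_total_fourth_moment:
  "(\<Sum>d\<in>Fp p. \<Sum>h\<in>Fp p. cmod (kloosterman d h) ^ 4) \<le> 3 * real p ^ 4"
proof -
  define W where "W = {1..<int p} \<times> {1..<int p} \<times> {1..<int p} \<times> {1..<int p}"
  define T where "T = (\<lambda>(k1, k2, k3, k4). inv_p k1 + inv_p k2 - inv_p k3 - inv_p k4)"
  define S :: "int \<times> int \<times> int \<times> int \<Rightarrow> int" where "S = (\<lambda>(k1, k2, k3, k4). k1 + k2 - k3 - k4)"
  have [simp]: "finite W" by (simp add: W_def)
  have "complex_of_real (cmod (kloosterman d h) ^ 4) = (\<Sum>q\<in>W. e_mod p (d * T q) * e_mod p (h * S q))" for d h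
  proof -
    define g where "g = (\<lambda>k. e_mod p (d * inv_p k + h * k))"
    let ?s = "\<lambda>f. \<Sum>k\<in>{1..<int p}. f k"
    have "complex_of_real (cmod (kloosterman d h) ^ 4) = (complex_of_real ((cmod (kloosterman d h))\<^sup>2))\<^sup>2"
      by (simp flip: power_mult)
    also have "\<dots> = ?s g * (?s g * (?s (\<lambda>k. cnj (g k)) * ?s (\<lambda>k. cnj (g k))))"
      unfolding complex_norm_square kloosterman_def g_def by (simp add: power2_eq_square)
    also have "\<dots> = (\<Sum>k1\<in>{1..<int p}. \<Sum>k2\<in>{1..<int p}. \<Sum>k3\<in>{1..<int p}. \<Sum>k4\<in>{1..<int p}.
        g k1 * (g k2 * (cnj (g k3) * cnj (g k4))))"
      by (simp only: sum_distrib_right) (simp only: sum_distrib_left)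
    also have "\<dots> = (\<Sum>(k1, k2, k3, k4)\<in>W. g k1 * (g k2 * (cnj (g k3) * cnj (g k4))))"
      by (simp add: W_def sum.cartesian_product)
    also have "\<dots> = (\<Sum>q\<in>W. e_mod p (d * T q) * e_mod p (h * S q))"
      by (intro sum.cong refl)
         (simp add: g_def T_def S_def cnj_e_mod e_mod_add[symmetric] case_prod_unfold algebra_simps)
    finally show ?thesis .
  qed
  hence "complex_of_real (\<Sum>d\<in>Fp p. \<Sum>h\<in>Fp p. cmod (kloosterman d h) ^ 4)
      = (\<Sum>d\<in>Fp p. \<Sum>h\<in>Fp p. \<Sum>q\<in>W. e_mod p (d * T q) * e_mod p (h * S q))"
    by (simp only: of_real_sum)
  also have "\<dots> = (\<Sum>d\<in>Fp p. \<Sum>q\<in>W. \<Sum>h\<in>Fp p. e_mod p (d * T q) * e_mod p (h * S q))"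
    by (intro sum.cong refl sum.swap)
  also have "\<dots> = (\<Sum>q\<in>W. \<Sum>d\<in>Fp p. \<Sum>h\<in>Fp p. e_mod p (d * T q) * e_mod p (h * S q))"
    by (rule sum.swap)
  also have "\<dots> = (\<Sum>q\<in>W. if int p dvd T q \<and> int p dvd S q then (of_nat p)\<^sup>2 else 0)"
    unfolding sum_product[symmetric] sum_e_mod[OF p_pos]
    by (intro sum.cong refl) (simp add: power2_eq_square)
  also have "\<dots> = complex_of_real (real (card {q \<in> W. int p dvd T q \<and> int p dvd S q}) * (real p)\<^sup>2)"
    by (simp add: sum.inter_filter[symmetric])
  finally have "(\<Sum>d\<in>Fp p. \<Sum>h\<in>Fp p. cmod (kloosterman d h) ^ 4)
      = real (card {q \<in> W. int p dvd T q \<and> int p dvd S q}) * (real p)\<^sup>2"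
    by (simp only: of_real_eq_iff)
  also have "\<dots> \<le> real (3 * p\<^sup>2) * (real p)\<^sup>2"
  proof (intro mult_right_mono of_nat_mono)
    have "{q \<in> W. int p dvd T q \<and> int p dvd S q} =
      {(k1, k2, k3, k4). k1 \<in> {1..<int p} \<and> k2 \<in> {1..<int p} \<and> k3 \<in> {1..<int p} \<and> k4 \<in> {1..<int p}
      \<and> int p dvd inv_p k1 + inv_p k2 - inv_p k3 - inv_p k4 \<and> int p dvd k1 + k2 - k3 - k4}"
      by (auto simp: W_def T_def S_def)
    thus "card {q \<in> W. int p dvd T q \<and> int p dvd S q} \<le> 3 * p\<^sup>2"
      using kloosterman_quadruples by simp
  qed auto
  finally show ?thesis by (simp add: power2_eq_square power4_eq_xxxx mult.assoc)
qed

lemma kloosterman_cong: "[d = d'] (mod int p) \<Longrightarrow> kloosterman d h = kloosterman d' h"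
  unfolding kloosterman_def by (intro sum.cong refl e_mod_cong cong_add cong_mult) auto

text \<open>Substitute h k for k. Consequently the fourth moment over \<open>d\<close> is the same
  for every unit \<open>h\<close>, and averaging over \<open>h\<close> loses nothing.\<close>

lemma kloosterman_scale:
  assumes h: "\<not> int p dvd h"
  shows "kloosterman d h = kloosterman (h * d) 1"
proof -
  have bij: "bij_betw (\<lambda>k. h * k mod int p) {1..<int p} {1..<int p}"
    using h by (intro bij_betw_int_remainders_mult) (simp add: coprime_p_iff)
  have "kloosterman (h * d) 1 = (\<Sum>k\<in>{1..<int p}. e_mod p (h * d * inv_p (h * k mod int p) + 1 * (h * k mod int p)))"
    unfolding kloosterman_def by (rule sum.reindex_bij_betw[OF bij, symmetric])
  also have "\<dots> = kloosterman d h"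
    unfolding kloosterman_def
  proof (intro sum.cong refl e_mod_cong[OF p_pos] cong_add)
    fix k assume k: "k \<in> {1..<int p}"
    have "[(h * k) * (inv_p h * inv_p k) = 1] (mod int p)"
      using cong_mult[OF inv_p_right[OF h] inv_p_right[OF unit_not_dvd[OF k]]] by (simp add: mult_ac)
    hence "[inv_p (h * k) = inv_p h * inv_p k] (mod int p)" by (rule inv_p_unique)
    moreover have "inv_p (h * k mod int p) = inv_p (h * k)" by (rule inv_p_cong) simp
    ultimately have "[h * d * inv_p (h * k mod int p) = h * d * (inv_p h * inv_p k)] (mod int p)"
      by (simp add: cong_mult)
    also have "h * d * (inv_p h * inv_p k) = (h * inv_p h) * (d * inv_p k)" by simp
    also have "[(h * inv_p h) * (d * inv_p k) = 1 * (d * inv_p k)] (mod int p)"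
      by (intro cong_mult cong_refl inv_p_right h)
    finally show "[h * d * inv_p (h * k mod int p) = d * inv_p k] (mod int p)" by simp
  qed simp
  finally show ?thesis ..
qed

lemma bij_betw_Fp_mult:
  assumes h: "\<not> int p dvd h"
  shows "bij_betw (\<lambda>k. h * k mod int p) (Fp p) (Fp p)"
proof -
  have "inj_on (\<lambda>k. h * k mod int p) (Fp p)"
  proof (rule inj_onI)
    fix x y assume xy: "x \<in> Fp p" "y \<in> Fp p" "h * x mod int p = h * y mod int p"
    hence "[x = y] (mod int p)" by - (rule cong_cancel_left[OF h], simp add: cong_def)
    thus "x = y" using xy by (intro cong_Fp_imp_eq)
  qed
  moreover have "(\<lambda>k. h * k mod int p) ` Fp p \<subseteq> Fp p" by (auto simp: Fp_def)
  ultimately show ?thesis by (simp add: bij_betw_def endo_inj_surj)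
qed

text \<open>Inversion permutes the units, so this is the full character sum without its term at
  0.\<close>

lemma kloosterman_0_right:
  assumes d: "\<not> int p dvd d"
  shows "kloosterman d 0 = - 1"
proof -
  have "inj_on inv_p {1..<int p}"
  proof (rule inj_onI)
    fix x y assume xy: "x \<in> {1..<int p}" "y \<in> {1..<int p}" "inv_p x = inv_p y"
    have "[inv_p x * x = inv_p x * y] (mod int p)"
      using inv_p_right[OF unit_not_dvd[OF xy(1)]] inv_p_right[OF unit_not_dvd[OF xy(2)]] xy(3)
      by (metis cong_sym cong_trans mult.commute)
    hence "[x = y] (mod int p)" by (rule cong_cancel_left[OF not_dvd_inv_p[OF unit_not_dvd[OF xy(1)]]])
    thus "x = y" using xy by (intro unit_cong_imp_eq)
  qed
  moreover have "inv_p ` {1..<int p} \<subseteq> {1..<int p}"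
  proof
    fix x assume "x \<in> inv_p ` {1..<int p}"
    then obtain k where k: "k \<in> {1..<int p}" "x = inv_p k" by auto
    have "x \<noteq> 0" using not_dvd_inv_p[OF unit_not_dvd[OF k(1)]] k(2) by auto
    thus "x \<in> {1..<int p}"
      using k modular_inverse_int_nonneg[of "int p" k] modular_inverse_int_less[of "int p" k] by auto
  qed
  ultimately have bij: "bij_betw inv_p {1..<int p} {1..<int p}" by (simp add: bij_betw_def endo_inj_surj)
  have "kloosterman d 0 = (\<Sum>k\<in>{1..<int p}. e_mod p (inv_p k * d))"
    by (simp add: kloosterman_def mult.commute)
  also have "\<dots> = (\<Sum>k\<in>{1..<int p}. e_mod p (k * d))" by (rule sum.reindex_bij_betw[OF bij])
  also have "\<dots> = (\<Sum>k\<in>Fp p. e_mod p (k * d)) - 1"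
  proof -
    have "Fp p = insert 0 {1..<int p}" by (auto simp: Fp_def)
    thus ?thesis by simp
  qed
  finally show ?thesis using d by (simp add: sum_e_mod)
qed

text \<open>For units \<open>h\<close> all moments coincide, so p - 1 copies of one moment are at
  most 3 p^4, and p - 1 >= p / 2 turns 3 into 6. The residue d = 0 is left out because for h = 0 its
  term would be (p - 1)^4; the other sums then have modulus 1.\<close>

lemma kloosterman_fourth_moment:
  "(\<Sum>d\<in>{1..<int p}. cmod (kloosterman d h) ^ 4) \<le> 6 * real p ^ 3"
proof (cases "int p dvd h")
  case True
  have "cmod (kloosterman d h) = 1" if "d \<in> {1..<int p}" for d
  proof -
    have "kloosterman d h = kloosterman d 0"
      using True unfolding kloosterman_def
      by (intro sum.cong refl e_mod_cong cong_add cong_mult) (auto simp: cong_0_iff)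
    thus ?thesis using kloosterman_0_right[OF unit_not_dvd[OF that]] by simp
  qed
  hence "(\<Sum>d\<in>{1..<int p}. cmod (kloosterman d h) ^ 4) = real (p - 1)"
    using prime_ge_1_nat[OF prime_p] by (simp add: of_nat_diff)
  also have "\<dots> \<le> real p ^ 1" by simp
  also have "\<dots> \<le> real p ^ 3" using prime_ge_1_nat[OF prime_p] by (intro power_increasing) auto
  finally show ?thesis by (rule order.trans) simp
next
  case False
  define T where "T = (\<Sum>d\<in>Fp p. cmod (kloosterman d 1) ^ 4)"
  have T: "(\<Sum>d\<in>Fp p. cmod (kloosterman d h) ^ 4) = T" if h: "\<not> int p dvd h" for h
  proof -
    have "(\<Sum>d\<in>Fp p. cmod (kloosterman d h) ^ 4) = (\<Sum>d\<in>Fp p. cmod (kloosterman (h * d mod int p) 1) ^ 4)"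
    proof (intro sum.cong refl)
      fix d
      have "kloosterman d h = kloosterman (h * d mod int p) 1"
        unfolding kloosterman_scale[OF h] by (rule kloosterman_cong) simp
      thus "cmod (kloosterman d h) ^ 4 = cmod (kloosterman (h * d mod int p) 1) ^ 4" by simp
    qed
    also have "\<dots> = T" unfolding T_def by (rule sum.reindex_bij_betw[OF bij_betw_Fp_mult[OF h]])
    finally show ?thesis .
  qed
  have p2: "real p \<ge> 2" using prime_ge_2_nat[OF prime_p] by simp
  have "real (p - 1) * T = (\<Sum>h\<in>{1..<int p}. \<Sum>d\<in>Fp p. cmod (kloosterman d h) ^ 4)"
    using T unit_not_dvd by simp
  also have "\<dots> \<le> (\<Sum>h\<in>Fp p. \<Sum>d\<in>Fp p. cmod (kloosterman d h) ^ 4)"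
    by (intro sum_mono2 sum_nonneg) (auto simp: Fp_def)
  also have "\<dots> \<le> 3 * real p ^ 4"
    using kloosterman_total_fourth_moment by (subst sum.swap)
  finally have le: "real (p - 1) * T \<le> 3 * real p ^ 4" .
  have "T \<ge> 0" unfolding T_def by (intro sum_nonneg) auto
  moreover have "real p / 2 \<le> real (p - 1)" using p2 by (simp add: of_nat_diff)
  ultimately have "real p / 2 * T \<le> 3 * real p ^ 4" using le mult_right_mono order.trans by blast
  hence "real p * T \<le> real p * (6 * real p ^ 3)" by (simp add: power_numeral_reduce)
  hence "T \<le> 6 * real p ^ 3" using p2 by simp
  moreover have "(\<Sum>d\<in>{1..<int p}. cmod (kloosterman d h) ^ 4) \<le> (\<Sum>d\<in>Fp p. cmod (kloosterman d h) ^ 4)"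
    by (intro sum_mono2) (auto simp: Fp_def)
  ultimately show ?thesis using T[OF False] by simp
qed

text \<open>For fixed \<open>n\<close> the values a (m - n) are distinct nonzero residues, so the
  fourth moment bounds each inner sum. The power mean over at most M^2 pairs adds (M^2)^3 to the
  factor M from summing over \<open>n\<close>.\<close>

lemma kloosterman_difference_sum:
  fixes a h :: int and \<M> :: "int set"
  assumes \<M>: "\<M> \<subseteq> Fp p" and a: "\<not> int p dvd a"
  shows "(\<Sum>(m, n)\<in>{(m, n). m \<in> \<M> \<and> n \<in> \<M> \<and> m \<noteq> n}. cmod (kloosterman (a * (m - n)) h)) ^ 4
    \<le> 6 * real (card \<M>) ^ 7 * real p ^ 3"
proof -
  define Off where "Off = {(m, n). m \<in> \<M> \<and> n \<in> \<M> \<and> m \<noteq> n}"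
  define f where "f = (\<lambda>(m, n). cmod (kloosterman (a * (m - n)) h))"
  have fin_\<M>: "finite \<M>" using \<M> finite_Fp finite_subset by blast
  have sub: "Off \<subseteq> \<M> \<times> \<M>" by (auto simp: Off_def)
  have fin: "finite Off" by (rule finite_subset[OF sub]) (simp add: fin_\<M>)
  have "card Off \<le> card (\<M> \<times> \<M>)" by (rule card_mono[OF _ sub]) (simp add: fin_\<M>)
  hence card_Off: "real (card Off) \<le> (real (card \<M>))\<^sup>2"
    by (simp add: card_cartesian_product power2_eq_square flip: of_nat_mult)
  have "(\<Sum>z\<in>Off. f z ^ 4) = (\<Sum>n\<in>\<M>. \<Sum>m\<in>\<M> - {n}. cmod (kloosterman (a * (m - n)) h) ^ 4)"
    by (subst sum.Sigma, simp add: fin_\<M>, simp add: fin_\<M>)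
       (rule sum.reindex_bij_witness[of _ prod.swap prod.swap], auto simp: Off_def f_def)
  also have "\<dots> \<le> (\<Sum>n\<in>\<M>. 6 * real p ^ 3)"
  proof (rule sum_mono)
    fix n assume n: "n \<in> \<M>"
    define g where "g = (\<lambda>m. a * (m - n) mod int p)"
    have inj: "inj_on g (\<M> - {n})"
    proof (rule inj_onI)
      fix x y assume xy: "x \<in> \<M> - {n}" "y \<in> \<M> - {n}" "g x = g y"
      hence "[x - n = y - n] (mod int p)" by - (rule cong_cancel_left[OF a], simp add: g_def cong_def)
      hence "[x = y] (mod int p)" by (simp add: cong_iff_dvd_diff)
      thus "x = y" using xy \<M> by (intro cong_Fp_imp_eq) auto
    qed
    have img: "g ` (\<M> - {n}) \<subseteq> {1..<int p}"
    proof (rule image_subsetI)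
      fix m assume m: "m \<in> \<M> - {n}"
      have "\<not> int p dvd m - n" using m n \<M> cong_Fp_imp_eq[of m n] by (auto simp: cong_iff_dvd_diff)
      hence "\<not> int p dvd a * (m - n)" using a prime_int_p by (simp add: prime_dvd_mult_iff)
      hence "g m \<noteq> 0" by (simp add: g_def dvd_eq_mod_eq_0)
      moreover have "0 \<le> g m" "g m < int p" by (simp_all add: g_def)
      ultimately show "g m \<in> {1..<int p}" by simp
    qed
    have "(\<Sum>m\<in>\<M> - {n}. cmod (kloosterman (a * (m - n)) h) ^ 4) = (\<Sum>m\<in>\<M> - {n}. cmod (kloosterman (g m) h) ^ 4)"
    proof (intro sum.cong refl)
      fix m
      have "kloosterman (a * (m - n)) h = kloosterman (g m) h" by (rule kloosterman_cong) (simp add: g_def)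
      thus "cmod (kloosterman (a * (m - n)) h) ^ 4 = cmod (kloosterman (g m) h) ^ 4" by simp
    qed
    also have "\<dots> = (\<Sum>d\<in>g ` (\<M> - {n}). cmod (kloosterman d h) ^ 4)" by (simp add: sum.reindex[OF inj])
    also have "\<dots> \<le> (\<Sum>d\<in>{1..<int p}. cmod (kloosterman d h) ^ 4)" by (rule sum_mono2[OF _ img]) auto
    also have "\<dots> \<le> 6 * real p ^ 3" by (rule kloosterman_fourth_moment)
    finally show "(\<Sum>m\<in>\<M> - {n}. cmod (kloosterman (a * (m - n)) h) ^ 4) \<le> 6 * real p ^ 3" .
  qed
  finally have S4: "(\<Sum>z\<in>Off. f z ^ 4) \<le> real (card \<M>) * (6 * real p ^ 3)" by simp
  have "(\<Sum>z\<in>Off. f z) ^ Suc 3 \<le> real (card Off) ^ 3 * (\<Sum>z\<in>Off. f z ^ Suc 3)"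
    by (rule power_mean_card) (simp add: f_def case_prod_unfold)
  also have "\<dots> \<le> ((real (card \<M>))\<^sup>2) ^ 3 * (real (card \<M>) * (6 * real p ^ 3))"
    using S4 card_Off by (intro mult_mono power_mono) (auto intro!: sum_nonneg simp: f_def)
  also have "\<dots> = 6 * real (card \<M>) ^ 7 * real p ^ 3" by (simp flip: power_mult add: power_numeral_reduce)
  finally show ?thesis by (simp add: Off_def f_def)
qed

text \<open>Fourier inversion modulo \<open>p\<close>: Kloosterman sums are the Fourier coefficients
  of the function k |-> e_p(d / k) extended by 0.\<close>

lemma inv_char_fourier:
  "of_nat p * inv_char d k = (\<Sum>h\<in>Fp p. kloosterman d (- h) * e_mod p (h * k))"
proof -
  have "(\<Sum>h\<in>Fp p. kloosterman d (- h) * e_mod p (h * k))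
      = (\<Sum>h\<in>Fp p. \<Sum>l\<in>{1..<int p}. e_mod p (d * inv_p l) * e_mod p (h * (k - l)))"
    unfolding kloosterman_def sum_distrib_right e_mod_add[symmetric]
    by (intro sum.cong refl) (simp add: algebra_simps)
  also have "\<dots> = (\<Sum>l\<in>{1..<int p}. e_mod p (d * inv_p l) * (\<Sum>h\<in>Fp p. e_mod p (h * (k - l))))"
    unfolding sum_distrib_left by (rule sum.swap)
  also have "\<dots> = (\<Sum>l\<in>{1..<int p}. if l = k mod int p then e_mod p (d * inv_p l) * of_nat p else 0)"
  proof (intro sum.cong refl)
    fix l assume l: "l \<in> {1..<int p}"
    have "int p dvd k - l \<longleftrightarrow> l = k mod int p"
      using l by (auto simp: mod_eq_dvd_iff[symmetric])
    thus "e_mod p (d * inv_p l) * (\<Sum>h\<in>Fp p. e_mod p (h * (k - l)))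
        = (if l = k mod int p then e_mod p (d * inv_p l) * of_nat p else 0)"
      by (simp add: sum_e_mod)
  qed
  also have "\<dots> = (if k mod int p \<in> {1..<int p} then e_mod p (d * inv_p (k mod int p)) * of_nat p else 0)"
    by (rule sum.delta) simp
  also have "\<dots> = of_nat p * inv_char d k"
  proof -
    have "z \<in> {1..<int p} \<longleftrightarrow> z \<noteq> 0" if "0 \<le> z" "z < int p" for z using that by auto
    from this[of "k mod int p"] have "k mod int p \<in> {1..<int p} \<longleftrightarrow> \<not> int p dvd k"
      by (simp add: dvd_eq_mod_eq_0)
    moreover have "inv_p (k mod int p) = inv_p k" by (rule inv_p_cong) simp
    ultimately show ?thesis by (simp add: inv_char_def)
  qed
  finally show ?thesis ..
qed

lemma parseval_interval:
  assumes "K \<le> p"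
  shows "(\<Sum>h\<in>Fp p. (cmod (\<Sum>i\<in>{X + 1..X + int K}. e_mod p (h * i)))\<^sup>2) = real p * real K"
proof -
  let ?I = "{X + 1..X + int K}"
  have "complex_of_real (\<Sum>h\<in>Fp p. (cmod (\<Sum>i\<in>?I. e_mod p (h * i)))\<^sup>2)
      = (\<Sum>h\<in>Fp p. \<Sum>i\<in>?I. \<Sum>j\<in>?I. e_mod p (h * (i - j)))"
    unfolding of_real_sum complex_norm_square cnj_sum sum_product
    by (simp add: cnj_e_mod e_mod_add[symmetric] algebra_simps)
  also have "\<dots> = (\<Sum>i\<in>?I. \<Sum>h\<in>Fp p. \<Sum>j\<in>?I. e_mod p (h * (i - j)))"
    by (rule sum.swap)
  also have "\<dots> = (\<Sum>i\<in>?I. \<Sum>j\<in>?I. \<Sum>h\<in>Fp p. e_mod p (h * (i - j)))"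
    by (intro sum.cong refl sum.swap)
  also have "\<dots> = (\<Sum>i\<in>?I. \<Sum>j\<in>?I. if j = i then of_nat p else 0)"
  proof (intro sum.cong refl)
    fix i j assume ij: "i \<in> ?I" "j \<in> ?I"
    have "int p dvd i - j \<longleftrightarrow> j = i"
    proof
      assume "int p dvd i - j"
      moreover have "\<bar>i - j\<bar> < int p" using ij assms by auto
      ultimately show "j = i" using dvd_imp_le_int[of "i - j" "int p"] by fastforce
    qed simp
    thus "(\<Sum>h\<in>Fp p. e_mod p (h * (i - j))) = (if j = i then of_nat p else 0)" by (simp add: sum_e_mod)
  qed
  also have "\<dots> = complex_of_real (real p * real K)" by (simp add: sum.delta)
  finally show ?thesis by (simp only: of_real_eq_iff)
qed

text \<open>The majorant counts representations k = i - j with \<open>j\<close> in an interval of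
  length \<open>K\<close> and \<open>i\<close> in one of length 2K; every \<open>k\<close> of the
  given interval has \<open>K\<close> of them. Its Fourier coefficients are products of two interval
  sums, so Parseval bounds their absolute sum without the logarithm of a sharp cut-off.\<close>

lemma interval_mean_square_kloosterman:
  fixes \<alpha> :: "int \<Rightarrow> complex" and \<M> :: "int set" and K :: nat and K0 a :: int
  defines "M \<equiv> real (card \<M>)"
  assumes \<M>: "\<M> \<subseteq> Fp p" and \<alpha>: "\<And>m. m \<in> \<M> \<Longrightarrow> cmod (\<alpha> m) \<le> A" and a: "\<not> int p dvd a"
    and K: "0 < K" "K \<le> p"
  shows "(\<Sum>k\<in>{K0 + 1..K0 + int K}. (cmod (\<Sum>m\<in>\<M>. \<alpha> m * inv_char (a * m) k))\<^sup>2)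
      \<le> A\<^sup>2 * (2 * M * real K + 2 * root 4 (6 * M ^ 7 * real p ^ 3))"
proof -
  define F where "F = (\<lambda>k. (cmod (\<Sum>m\<in>\<M>. \<alpha> m * inv_char (a * m) k))\<^sup>2)"
  define I1 where "I1 = {0 + 1..0 + int K}"
  define I2 where "I2 = {K0 + 1..K0 + int K}"
  define I3 where "I3 = {(K0 + int K) + 1..(K0 + int K) + int K}"
  define J where "J = I1 \<times> (I2 \<union> I3)"
  define E where "E = (\<lambda>I h. \<Sum>i\<in>I. e_mod p (h * i))"
  define Off where "Off = {(m, n). m \<in> \<M> \<and> n \<in> \<M> \<and> m \<noteq> n}"
  define B where "B = root 4 (6 * M ^ 7 * real p ^ 3)"
  have fin_\<M>: "finite \<M>" using \<M> finite_Fp finite_subset by blast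
  have disj: "I2 \<inter> I3 = {}" by (auto simp: I2_def I3_def)
  have [simp]: "finite I1" "finite I2" "finite I3" by (simp_all add: I1_def I2_def I3_def)
  have card_J: "real (card J) = 2 * (real K)\<^sup>2"
    using disj by (simp add: J_def card_cartesian_product card_Un_disjoint power2_eq_square)
       (simp add: I1_def I2_def I3_def)

  have "real K * (\<Sum>k\<in>I2. F k) = (\<Sum>j\<in>I1. \<Sum>k\<in>I2. F k)" by (simp add: I1_def)
  also have "\<dots> \<le> (\<Sum>j\<in>I1. \<Sum>i\<in>I2 \<union> I3. F (i - j))"
  proof (rule sum_mono)
    fix j assume j: "j \<in> I1"
    have "(\<Sum>k\<in>I2. F k) = (\<Sum>i\<in>(\<lambda>k. k + j) ` I2. F (i - j))"
      by (subst sum.reindex) (auto simp: inj_on_def)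
    also have "\<dots> \<le> (\<Sum>i\<in>I2 \<union> I3. F (i - j))"
      using j by (intro sum_mono2) (auto simp: F_def I1_def I2_def I3_def)
    finally show "(\<Sum>k\<in>I2. F k) \<le> (\<Sum>i\<in>I2 \<union> I3. F (i - j))" .
  qed
  also have "\<dots> = (\<Sum>(j, i)\<in>J. F (i - j))" by (simp add: J_def sum.cartesian_product)
  also have "\<dots> \<le> A\<^sup>2 * (M * real (card J)
      + (\<Sum>(m, n)\<in>Off. cmod (\<Sum>(j, i)\<in>J. inv_char (a * (m - n)) (i - j))))"
    unfolding M_def Off_def F_def
    using bilinear_square_expand[OF fin_\<M> \<alpha>, where a = a and \<kappa> = "\<lambda>(j, i). i - j" and J = J]
    by (simp only: case_prod_unfold)
  also have "(\<Sum>(m, n)\<in>Off. cmod (\<Sum>(j, i)\<in>J. inv_char (a * (m - n)) (i - j))) \<le> 2 * real K * B"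
  proof -
    have fourier: "of_nat p * (\<Sum>(j, i)\<in>J. inv_char d (i - j))
        = (\<Sum>h\<in>Fp p. kloosterman d (- h) * (cnj (E I1 h) * E (I2 \<union> I3) h))" for d
    proof -
      have "of_nat p * (\<Sum>(j, i)\<in>J. inv_char d (i - j))
          = (\<Sum>z\<in>J. \<Sum>h\<in>Fp p. kloosterman d (- h) * e_mod p (h * (snd z - fst z)))"
        unfolding sum_distrib_left case_prod_unfold inv_char_fourier ..
      also have "\<dots> = (\<Sum>h\<in>Fp p. kloosterman d (- h) * (\<Sum>z\<in>J. e_mod p (h * (snd z - fst z))))"
        unfolding sum_distrib_left by (rule sum.swap)
      also have "\<dots> = (\<Sum>h\<in>Fp p. kloosterman d (- h) * (cnj (E I1 h) * E (I2 \<union> I3) h))"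
      proof (intro sum.cong refl arg_cong2[of _ _ _ _ "(*)"])
        fix h
        show "(\<Sum>z\<in>J. e_mod p (h * (snd z - fst z))) = cnj (E I1 h) * E (I2 \<union> I3) h"
          unfolding E_def cnj_sum sum_product J_def sum.cartesian_product
          by (intro sum.cong refl)
             (simp add: case_prod_unfold cnj_e_mod e_mod_add[symmetric] right_diff_distrib)
      qed
      finally show ?thesis .
    qed
    have "real p * (\<Sum>(m, n)\<in>Off. cmod (\<Sum>(j, i)\<in>J. inv_char (a * (m - n)) (i - j)))
        = (\<Sum>(m, n)\<in>Off. cmod (of_nat p * (\<Sum>(j, i)\<in>J. inv_char (a * (m - n)) (i - j))))"
      by (simp add: case_prod_unfold norm_mult flip: sum_distrib_left)
    also have "\<dots> \<le> (\<Sum>(m, n)\<in>Off. \<Sum>h\<in>Fp p. cmod (kloosterman (a * (m - n)) (- h))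
        * (cmod (E I1 h) * cmod (E (I2 \<union> I3) h)))"
      unfolding fourier
      by (intro sum_mono, clarify, intro sum_norm_le) (simp add: norm_mult)
    also have "\<dots> = (\<Sum>h\<in>Fp p. (\<Sum>(m, n)\<in>Off. cmod (kloosterman (a * (m - n)) (- h)))
        * (cmod (E I1 h) * cmod (E (I2 \<union> I3) h)))"
      unfolding sum_distrib_right case_prod_unfold by (rule sum.swap)
    also have "\<dots> \<le> (\<Sum>h\<in>Fp p. B * ((cmod (E I1 h))\<^sup>2 + ((cmod (E I2 h))\<^sup>2 + (cmod (E I3 h))\<^sup>2) / 2))"
    proof (intro sum_mono mult_mono)
      fix h
      have "(\<Sum>(m, n)\<in>Off. cmod (kloosterman (a * (m - n)) (- h)))
          = root 4 ((\<Sum>(m, n)\<in>Off. cmod (kloosterman (a * (m - n)) (- h))) ^ 4)"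
        by (rule real_root_power_cancel[symmetric]) (auto intro!: sum_nonneg)
      also have "\<dots> \<le> B"
        unfolding B_def M_def Off_def
        by (intro real_root_le_mono kloosterman_difference_sum[OF \<M> a]) auto
      finally show "(\<Sum>(m, n)\<in>Off. cmod (kloosterman (a * (m - n)) (- h))) \<le> B" .
      \<comment> \<open>The long interval is split in two because 2K may exceed \<open>p\<close>,
        whereas the Parseval identity is stated for lengths up to \<open>p\<close>.\<close>
      have "cmod (E (I2 \<union> I3) h) \<le> cmod (E I2 h) + cmod (E I3 h)"
        unfolding E_def using disj by (simp add: sum.union_disjoint norm_triangle_ineq)
      hence "cmod (E I1 h) * cmod (E (I2 \<union> I3) h) \<le> cmod (E I1 h) * (cmod (E I2 h) + cmod (E I3 h))"
        by (intro mult_left_mono) auto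
      also have "\<dots> \<le> (cmod (E I1 h))\<^sup>2 + ((cmod (E I2 h))\<^sup>2 + (cmod (E I3 h))\<^sup>2) / 2"
        using sum_squares_bound[of "cmod (E I1 h)" "cmod (E I2 h)"]
          sum_squares_bound[of "cmod (E I1 h)" "cmod (E I3 h)"]
        unfolding distrib_left add_divide_distrib by (simp add: mult.assoc)
      finally show "cmod (E I1 h) * cmod (E (I2 \<union> I3) h)
          \<le> (cmod (E I1 h))\<^sup>2 + ((cmod (E I2 h))\<^sup>2 + (cmod (E I3 h))\<^sup>2) / 2" .
    qed (auto simp: B_def M_def)
    also have "\<dots> = B * (real p * real K + (real p * real K + real p * real K) / 2)"
      unfolding sum_distrib_left[symmetric] sum.distrib sum_divide_distrib[symmetric]
      unfolding E_def I1_def I2_def I3_def parseval_interval[OF K(2)] ..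
    also have "\<dots> = real p * (2 * real K * B)" by (simp add: mult_ac)
    finally show ?thesis using p_pos by simp
  qed
  finally have "real K * (\<Sum>k\<in>I2. F k) \<le> A\<^sup>2 * (M * real (card J) + 2 * real K * B)"
    by (simp add: mult_left_mono)
  also have "\<dots> = real K * (A\<^sup>2 * (2 * M * real K + 2 * B))"
    by (simp add: card_J power2_eq_square algebra_simps)
  finally show ?thesis using K by (simp add: F_def I2_def B_def)
qed

end

section \<open>Combination of the two estimates\<close>

text \<open>The last factor comes from the moment. The rest is 256 * 4^n, from the doubled interval
  and the energy bound, times 2 * 4^(n + 1), lost in K <= 2 U V and T <= 2 V.\<close>

definition shift_const :: "nat \<Rightarrow> real" where
  "shift_const n = 2048 * 16 ^ n * (real (Suc n) ^ Suc n + 2 * real (Suc n))"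

lemma shift_const_ge_1: "shift_const n \<ge> 1"
proof -
  have "1 * 1 \<le> (2048 * 16 ^ n) * (real (Suc n) ^ Suc n + 2 * real (Suc n))"
    by (intro mult_mono) (auto intro: add_increasing simp: one_le_power mult_ge1_I)
  thus ?thesis by (simp add: shift_const_def)
qed

text \<open>Since V^r <= T^r = q, the moment factor is at most a constant times q^3. After division
  by (U V)^(2r) all but one power of \<open>U\<close> cancels, and U V^(2r) is at least K q^2 / T up
  to a constant.\<close>

lemma shift_arithmetic:
  fixes D M K U V q T H :: real
  assumes pos: "0 \<le> D" "0 < M" "0 < U" "0 < V" "0 < K" "0 < q" "1 \<le> H"
    and V: "V \<le> T" "T \<le> 2 * V" and T: "T ^ Suc n = q" and K: "K \<le> 2 * U * V"
    and D: "D ^ (2 * Suc n) \<le> (M\<^sup>2 * U * (2 * K)) ^ (2 * n)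
      * (32 * U * (2 * K) * (M ^ 3 * H\<^sup>2 + M ^ 4 * (2 * K)\<^sup>2 / q\<^sup>2))
      * (q * (real (Suc n) ^ Suc n * V ^ Suc n * q + 2 * real (Suc n) * V ^ (2 * Suc n)))"
  shows "(D / (U * V)) ^ (2 * Suc n)
    \<le> shift_const n * H\<^sup>2 * (M\<^sup>2 * K) ^ (2 * Suc n) * (T * q / (M * K\<^sup>2) + T / q)"
proof -
  define c where "c = real (Suc n) ^ Suc n + 2 * real (Suc n)"
  define E where "E = M ^ 3 + M ^ 4 * K\<^sup>2 / q\<^sup>2"
  define W where "W = U * V ^ (2 * Suc n)"
  have c: "c \<ge> 0" by (simp add: c_def)
  have T0: "T > 0" using pos V by simp
  have E0: "E \<ge> 0" using pos by (simp add: E_def)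
  have W0: "W > 0" using pos by (simp add: W_def)
  have Vq: "V ^ Suc n \<le> q" unfolding T[symmetric] using pos V by (intro power_mono) auto
  have V2q: "V ^ (2 * Suc n) \<le> q\<^sup>2"
    using power_mono[OF Vq, of 2] pos by (simp only: power_mult mult.commute[of 2]) simp
  have "q * (real (Suc n) ^ Suc n * V ^ Suc n * q + 2 * real (Suc n) * V ^ (2 * Suc n))
      \<le> q * (real (Suc n) ^ Suc n * q * q + 2 * real (Suc n) * q\<^sup>2)"
    using pos Vq V2q by (intro mult_left_mono add_mono mult_right_mono) auto
  also have "\<dots> = c * q ^ 3" by (simp add: c_def power2_eq_square power3_eq_cube algebra_simps)
  finally have third: "q * (real (Suc n) ^ Suc n * V ^ Suc n * q + 2 * real (Suc n) * V ^ (2 * Suc n)) \<le> c * q ^ 3" .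
  have H2: "1 \<le> H\<^sup>2" using pos by simp
  have "M ^ 3 * H\<^sup>2 + M ^ 4 * (2 * K)\<^sup>2 / q\<^sup>2 \<le> M ^ 3 * (4 * H\<^sup>2) + (M ^ 4 * K\<^sup>2 / q\<^sup>2) * (4 * H\<^sup>2)"
  proof (intro add_mono)
    show "M ^ 3 * H\<^sup>2 \<le> M ^ 3 * (4 * H\<^sup>2)" using pos by (intro mult_left_mono) auto
    have "(M ^ 4 * K\<^sup>2 / q\<^sup>2) * 4 \<le> (M ^ 4 * K\<^sup>2 / q\<^sup>2) * (4 * H\<^sup>2)"
      using H2 pos by (intro mult_left_mono) auto
    thus "M ^ 4 * (2 * K)\<^sup>2 / q\<^sup>2 \<le> (M ^ 4 * K\<^sup>2 / q\<^sup>2) * (4 * H\<^sup>2)"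
      by (simp add: power_mult_distrib mult_ac)
  qed
  hence second: "32 * U * (2 * K) * (M ^ 3 * H\<^sup>2 + M ^ 4 * (2 * K)\<^sup>2 / q\<^sup>2) \<le> 32 * U * (2 * K) * (4 * H\<^sup>2 * E)"
    using pos by (intro mult_left_mono) (auto simp: E_def algebra_simps)
  have "D ^ (2 * Suc n) \<le> (M\<^sup>2 * U * (2 * K)) ^ (2 * n) * (32 * U * (2 * K) * (4 * H\<^sup>2 * E)) * (c * q ^ 3)"
    using pos E0 c by (intro order.trans[OF D] mult_mono second third order.refl) auto
  also have "\<dots> = (256 * 4 ^ n * c * H\<^sup>2) * (M\<^sup>2 * K) ^ (2 * n) * (U ^ (2 * n) * U) * (K * E * q ^ 3)"
  proof -
    have "(2::real) ^ (n * 2) = 4 ^ n" by (subst mult.commute) (simp add: power_mult)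
    thus ?thesis by (simp add: power_mult_distrib mult_ac)
  qed
  finally have "(D / (U * V)) ^ (2 * Suc n)
      \<le> (256 * 4 ^ n * c * H\<^sup>2) * (M\<^sup>2 * K) ^ (2 * n) * (U ^ (2 * n) * U) * (K * E * q ^ 3) / (U ^ (2 * n) * U * W)"
    using pos W0 unfolding power_divide power_mult_distrib W_def
    by (intro frac_le) (auto simp: power2_eq_square mult_ac intro!: mult_nonneg_nonneg E0 c)
  also have "\<dots> = (256 * 4 ^ n * c * H\<^sup>2) * (M\<^sup>2 * K) ^ (2 * n) * (K * E * q ^ 3) / W"
    using pos by simp
  also have "\<dots> \<le> (256 * 4 ^ n * c * H\<^sup>2) * (M\<^sup>2 * K) ^ (2 * n) * (K * E * q ^ 3) / (K * q\<^sup>2 / (2 * T * 4 ^ Suc n))"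
  proof (intro divide_left_mono)
    have "q\<^sup>2 = T ^ (2 * Suc n)" unfolding T[symmetric] by (simp only: power_mult[symmetric] mult.commute[of 2])
    also have "\<dots> \<le> (2 * V) ^ (2 * Suc n)" using T0 V by (intro power_mono) auto
    also have "\<dots> = 4 ^ Suc n * V ^ (2 * Suc n)" by (simp only: power_mult_distrib power_mult) simp
    finally have q2: "q\<^sup>2 \<le> 4 ^ Suc n * V ^ (2 * Suc n)" .
    have "K \<le> 2 * U * T" using K V pos mult_left_mono[of V T "2 * U"] by linarith
    hence "K * q\<^sup>2 \<le> (2 * U * T) * (4 ^ Suc n * V ^ (2 * Suc n))"
      using q2 pos T0 by (intro mult_mono) auto
    thus "K * q\<^sup>2 / (2 * T * 4 ^ Suc n) \<le> W"
      using T0 by (subst pos_divide_le_eq) (simp_all add: W_def mult_ac)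
  qed (use pos T0 E0 W0 c in auto)
  also have "\<dots> = shift_const n * H\<^sup>2 * (M\<^sup>2 * K) ^ (2 * n) * (E * q * T)"
  proof -
    have "(16::real) ^ n = 4 ^ n * 4 ^ n" by (simp flip: power_mult_distrib)
    moreover have "shift_const n = 2048 * 16 ^ n * c" by (simp only: shift_const_def c_def)
    ultimately show ?thesis using pos T0 by (simp add: power2_eq_square power3_eq_cube)
  qed
  also have "\<dots> = shift_const n * H\<^sup>2 * (M\<^sup>2 * K) ^ (2 * Suc n) * (T * q / (M * K\<^sup>2) + T / q)"
  proof -
    have "E * q * T = (M\<^sup>2 * K)\<^sup>2 * (T * q / (M * K\<^sup>2) + T / q)"
      using pos by (simp add: E_def field_simps power2_eq_square power3_eq_cube power4_eq_xxxx)
    thus ?thesis by (simp add: power2_eq_square mult_ac)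
  qed
  finally show ?thesis .
qed

text \<open>The hypothesis excludes the range covered by the shift argument; writing \<open>M = w ^ 13\<close> turns
  all exponents into integers.\<close>

lemma kloosterman_range_arithmetic:
  fixes w K q T :: real
  assumes w: "1 \<le> w" "w ^ 26 \<le> q" and K: "0 < K" "q\<^sup>2 < K\<^sup>2 * w ^ 10" and n: "1 \<le> n"
    and T: "0 < T" "T ^ Suc n = q"
  shows "(q ^ 3 / (w ^ 13 * K ^ 4)) ^ Suc n \<le> (1 / K + T * q / (w ^ 10 * K\<^sup>2))\<^sup>2"
proof -
  define Z where "Z = q ^ 3 / (w ^ 13 * K ^ 4)"
  have q: "1 \<le> q" using w one_le_power[OF w(1), of 26] by linarith
  have wq: "w ^ i \<le> q" if "i \<le> 26" for i
    using power_increasing[OF that w(1)] w(2) by linarith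
  have Z0: "Z > 0" using q w K by (simp add: Z_def)
  show ?thesis
  proof (cases "n = 1")
    case True
    \<comment> \<open>Here r = 2 and T is the square root of q, so it is enough that Z is at most
      the third summand; this reduces to M^(7/13) <= q^(1/2).\<close>
    hence Tq: "T * T = q" using T by (simp add: power2_eq_square)
    have "(w ^ 7)\<^sup>2 \<le> T\<^sup>2" using wq[of 14] Tq by (simp add: power2_eq_square flip: power_add)
    hence w7: "w ^ 7 \<le> T" using T(1) by (rule power2_le_imp_le[OF _ less_imp_le])
    have "w ^ 7 * q\<^sup>2 \<le> T * (K\<^sup>2 * w ^ 10)" using w7 K w T by (intro mult_mono) auto
    also have "\<dots> = w ^ 7 * (T * w ^ 3 * K\<^sup>2)" by (simp add: power_numeral_reduce mult_ac)
    finally have "q\<^sup>2 \<le> T * w ^ 3 * K\<^sup>2" using w by simp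
    hence "q * q\<^sup>2 \<le> q * (T * w ^ 3 * K\<^sup>2)" using q by (intro mult_left_mono) auto
    hence "Z \<le> q * (T * w ^ 3 * K\<^sup>2) / (w ^ 13 * K ^ 4)"
      unfolding Z_def using w K by (intro divide_right_mono) (auto simp: power2_eq_square power3_eq_cube)
    also have "\<dots> = ((T * q) * (w ^ 3 * K\<^sup>2)) / ((w ^ 10 * K\<^sup>2) * (w ^ 3 * K\<^sup>2))"
      by (simp add: power_numeral_reduce mult_ac)
    also have "\<dots> = T * q / (w ^ 10 * K\<^sup>2)"
      using w K by (intro mult_divide_mult_cancel_right) auto
    also have "\<dots> \<le> 1 / K + T * q / (w ^ 10 * K\<^sup>2)" using K by simp
    finally have "Z\<^sup>2 \<le> (1 / K + T * q / (w ^ 10 * K\<^sup>2))\<^sup>2" using Z0 by (intro power_mono) auto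
    thus ?thesis using True by (simp add: Z_def power2_eq_square)
  next
    case False
    \<comment> \<open>For r >= 3, Z <= 1 lowers the exponent to 3, and 1 / K alone suffices: the
      needed q^9 <= M^3 K^10 follows from the range of \<open>K\<close> and M^(11/13) <= q.\<close>
    have "Z ^ Suc n \<le> Z ^ 3"
    proof (rule power_decreasing)
      have "q ^ 3 * w ^ 7 \<le> q ^ 3 * q" using wq[of 7] q by (intro mult_left_mono) auto
      also have "\<dots> = (q\<^sup>2)\<^sup>2" by (simp add: power_numeral_reduce)
      also have "\<dots> \<le> (K\<^sup>2 * w ^ 10)\<^sup>2" using K q by (intro power_mono) auto
      also have "\<dots> = (w ^ 13 * K ^ 4) * w ^ 7" by (simp add: power_numeral_reduce mult_ac)
      finally have "q ^ 3 \<le> w ^ 13 * K ^ 4" using w by simp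
      thus "Z \<le> 1" using w K by (simp add: Z_def)
    qed (use False n Z0 in auto)
    also have "Z ^ 3 \<le> (1 / K)\<^sup>2"
    proof -
      have "q ^ 9 * w ^ 11 \<le> q ^ 9 * q" using wq[of 11] q by (intro mult_left_mono) auto
      also have "\<dots> = (q\<^sup>2) ^ 5" by (simp add: power_numeral_reduce)
      also have "\<dots> \<le> (K\<^sup>2 * w ^ 10) ^ 5" using K q by (intro power_mono) auto
      also have "\<dots> = (w ^ 39 * K ^ 10) * w ^ 11"
        by (simp only: power_mult_distrib power_mult[symmetric]) (simp flip: power_add)
      finally have "q ^ 9 \<le> w ^ 39 * K ^ 10" using w by simp
      hence "q ^ 9 * K\<^sup>2 \<le> (w ^ 39 * K ^ 10) * K\<^sup>2" by (intro mult_right_mono) auto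
      also have "\<dots> = w ^ 39 * K ^ 12" by (simp flip: power_add add: mult.assoc)
      finally show ?thesis using w K
        by (simp add: Z_def power_divide power_mult_distrib pos_divide_le_eq pos_le_divide_eq
            flip: power_mult)
    qed
    also have "\<dots> \<le> (1 / K + T * q / (w ^ 10 * K\<^sup>2))\<^sup>2" using K q T w by (intro power_mono) auto
    finally show ?thesis by (simp add: Z_def)
  qed
qed

lemma harm_le_powr:
  fixes \<delta> :: real
  assumes \<delta>: "\<delta> > 0" and n: "n > 0"
  shows "harm n \<le> (1 + 1 / \<delta>) * real n powr \<delta>"
proof -
  have "harm n \<le> 1 + ln (real n)"
    using euler_mascheroni_sequence_decreasing[of 1 n] n by (simp add: harm_expand)
  also have "\<dots> \<le> real n powr \<delta> + real n powr \<delta> / \<delta>"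
    using n \<delta> by (intro add_mono ln_powr_bound ge_one_powr_ge_zero) auto
  finally show ?thesis by (simp add: algebra_simps)
qed

context prime_modulus
begin

text \<open>All contributions are compared with M^2 K Y, where Y is the 2r-th root of
  \<open>X\<close>: the diagonal costs a constant 2, the off-diagonal part 4, in either range, which
  gives the 6.\<close>

lemma interval_mean_square:
  fixes \<alpha> :: "int \<Rightarrow> complex" and \<M> :: "int set" and K n :: nat and K0 a :: int
  defines "M \<equiv> real (card \<M>)" and "T \<equiv> real p powr (1 / real (Suc n))"
  defines "X \<equiv> 1 / M ^ (2 * Suc n) + 1 / real K + T * real p / (M powr (10 / 13) * (real K)\<^sup>2)"
  assumes \<M>: "\<M> \<subseteq> Fp p" "\<M> \<noteq> {}" "M \<le> real p powr (1 / 2)"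
    and \<alpha>: "\<And>m. m \<in> \<M> \<Longrightarrow> cmod (\<alpha> m) \<le> A" and a: "\<not> int p dvd a"
    and n: "1 \<le> n" "Suc n < p" and K: "T \<le> real K" "K < p"
  shows "(\<Sum>k\<in>{K0 + 1..K0 + int K}. (cmod (\<Sum>m\<in>\<M>. \<alpha> m * inv_char (a * m) k))\<^sup>2)
      \<le> A\<^sup>2 * (M\<^sup>2 * real K * (6 * shift_const n * harm p * X powr (1 / (2 * real (Suc n)))))"
proof -
  define q where "q = real p"
  define Y where "Y = X powr (1 / (2 * real (Suc n)))"
  define w where "w = M powr (1 / 13)"
  define H :: real where "H = harm p"
  define Q where "Q = (\<Sum>k\<in>{K0 + 1..K0 + int K}. (cmod (\<Sum>m\<in>\<M>. \<alpha> m * inv_char (a * m) k))\<^sup>2)"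
  have fin_\<M>: "finite \<M>" using \<M>(1) finite_Fp finite_subset by blast
  have M1: "M \<ge> 1" using \<M>(2) fin_\<M> by (simp add: M_def Suc_le_eq card_gt_0_iff)
  have q2: "q \<ge> 2" using prime_ge_2_nat[OF prime_p] by (simp add: q_def)
  have T1: "T \<ge> 1" using q2 unfolding T_def q_def by (intro ge_one_powr_ge_zero) auto
  have Tq: "T ^ Suc n = q"
    using q2 by (simp add: T_def q_def powr_powr flip: powr_realpow del: power_Suc)
  have K1: "real K \<ge> 1" using T1 K by linarith
  have w1: "w \<ge> 1" using M1 unfolding w_def by (intro ge_one_powr_ge_zero) auto
  have w13: "w ^ 13 = M" using M1 by (simp add: w_def powr_powr flip: powr_realpow)
  have w10: "w ^ 10 = M powr (10 / 13)" using M1 by (simp add: w_def powr_powr flip: powr_realpow)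
  have "M\<^sup>2 \<le> (q powr (1 / 2))\<^sup>2" using \<M>(3) M1 by (intro power_mono) (auto simp: q_def)
  also have "\<dots> = q" using q2 by (simp add: powr_powr flip: powr_realpow)
  finally have w26: "w ^ 26 \<le> q" by (simp add: w13[symmetric] flip: power_mult)
  have H1: "H \<ge> 1"
    using harm_mono[of 1 p] p_pos unfolding H_def by (simp add: harm_expand Suc_le_eq)
  have X: "X = 1 / M ^ (2 * Suc n) + 1 / real K + T * q / (w ^ 10 * (real K)\<^sup>2)"
    by (simp add: X_def w10 q_def)
  have parts: "1 / M ^ (2 * Suc n) > 0" "1 / real K > 0" "T * q / (w ^ 10 * (real K)\<^sup>2) > 0"
    using M1 K1 T1 q2 w1 by auto
  have X0: "X > 0" using parts unfolding X by linarith
  have Y0: "Y > 0" using X0 by (simp add: Y_def)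
  have YX: "Y ^ (2 * Suc n) = X"
    using X0 by (simp add: Y_def powr_powr flip: powr_realpow del: power_Suc)
  have MY: "1 / M \<le> Y"
  proof (rule power_le_imp_le_base)
    show "(1 / M) ^ Suc (2 * n + 1) \<le> Y ^ Suc (2 * n + 1)"
      using YX parts unfolding X by (simp add: power_one_over)
  qed (use Y0 in simp)
  have C1: "shift_const n \<ge> 1" by (rule shift_const_ge_1)
  have CH: "1 \<le> shift_const n * H" using mult_mono[OF C1 H1] C1 by simp
  have diag: "2 * M * real K \<le> M\<^sup>2 * real K * (2 * (shift_const n * H) * Y)"
  proof -
    have "1 / M * 1 \<le> Y * (shift_const n * H)" using MY CH Y0 by (intro mult_mono) auto
    hence "M\<^sup>2 * real K * (2 * (1 / M)) \<le> M\<^sup>2 * real K * (2 * (Y * (shift_const n * H)))"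
      by (intro mult_left_mono) auto
    thus ?thesis using M1 by (simp add: power2_eq_square mult_ac)
  qed

  have "\<exists>B. Q \<le> A\<^sup>2 * (2 * M * real K + B) \<and> B \<le> M\<^sup>2 * real K * (4 * (shift_const n * H) * Y)"
  \<comment> \<open>As \<open>w ^ 10\<close> is M^(10/13), the threshold is the point where T / q
    overtakes the third summand of \<open>X\<close>.\<close>
  proof (cases "q\<^sup>2 < (real K)\<^sup>2 * w ^ 10")
    case True
    define B where "B = root 4 (6 * M ^ 7 * q ^ 3)"
    have B0: "B \<ge> 0" using M1 q2 by (simp add: B_def)
    have "(q ^ 3 / (M * real K ^ 4)) ^ Suc n \<le> (1 / real K + T * q / (w ^ 10 * (real K)\<^sup>2))\<^sup>2"
      unfolding w13[symmetric]
      using kloosterman_range_arithmetic[OF w1 w26 _ True n(1) _ Tq] K1 T1 by simp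
    also have "\<dots> \<le> X\<^sup>2" using parts unfolding X by (intro power_mono) auto
    also have "\<dots> = (Y ^ 4) ^ Suc n"
    proof -
      have "2 * Suc n * 2 = 4 * Suc n" by simp
      thus ?thesis unfolding YX[symmetric] by (simp only: power_mult[symmetric])
    qed
    finally have "q ^ 3 / (M * real K ^ 4) \<le> Y ^ 4"
      by (rule power_le_imp_le_base) simp
    hence "q ^ 3 \<le> Y ^ 4 * (M * real K ^ 4)" using M1 K1 by (simp add: pos_divide_le_eq)
    hence "6 * M ^ 7 * q ^ 3 \<le> 6 * M ^ 7 * (Y ^ 4 * (M * real K ^ 4))"
      using M1 by (intro mult_left_mono) auto
    also have "\<dots> = 6 * (M\<^sup>2 * real K * Y) ^ 4"
      by (simp add: power_mult_distrib power_numeral_reduce mult_ac)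
    \<comment> \<open>The constant 6 is absorbed by 2^4.\<close>
    also have "\<dots> \<le> (2 * (M\<^sup>2 * real K * Y)) ^ 4" by (simp add: power_mult_distrib mult_right_mono)
    finally have "B ^ 4 \<le> (2 * (M\<^sup>2 * real K * Y)) ^ 4"
      using M1 q2 by (simp add: B_def)
    hence "B ^ Suc 3 \<le> (2 * (M\<^sup>2 * real K * Y)) ^ Suc 3" by simp
    hence "B \<le> 2 * (M\<^sup>2 * real K * Y)"
      using Y0 by (intro power_le_imp_le_base[of B 3]) simp_all
    moreover have "2 * (M\<^sup>2 * real K * Y) * 1 \<le> 2 * (M\<^sup>2 * real K * Y) * (shift_const n * H)"
      using CH Y0 by (intro mult_left_mono) auto
    ultimately have "2 * B \<le> M\<^sup>2 * real K * (4 * (shift_const n * H) * Y)" by (simp add: mult_ac)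
    moreover have "Q \<le> A\<^sup>2 * (2 * M * real K + 2 * B)"
      unfolding Q_def B_def M_def q_def
      using K1 K(2) by (intro interval_mean_square_kloosterman \<M> \<alpha> a) auto
    ultimately show ?thesis by blast
  next
    case False
    \<comment> \<open>Since T >= 1 and K >= V, rounding costs at most a factor 2 each time: T <= 2 V
      and K <= 2 U V.\<close>
    define V where "V = nat \<lfloor>T\<rfloor>"
    define U where "U = K div V"
    have V: "V > 0" "real V \<le> T" "T \<le> 2 * real V"
    proof -
      have fl: "1 \<le> \<lfloor>T\<rfloor>" using T1 by simp
      hence eq: "real V = of_int \<lfloor>T\<rfloor>" by (simp add: V_def)
      show "V > 0" using fl by (simp add: V_def)
      show "real V \<le> T" unfolding eq by simp
      have "1 \<le> real V" using \<open>V > 0\<close> by simp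
      moreover have "T < real V + 1" unfolding eq by linarith
      ultimately show "T \<le> 2 * real V" by linarith
    qed
    have VK: "V \<le> K" using V(2) K(1) by linarith
    hence U: "U > 0" using V by (simp add: U_def div_greater_zero_iff)
    have UV: "U * V \<le> K" by (simp add: U_def)
    have "U \<le> K" by (simp add: U_def)
    hence Up: "U < p" using K by simp
    have Vp: "V < p" using VK K(2) by simp
    have "K = U * V + K mod V" by (simp add: U_def)
    moreover have "K mod V < V" using V by simp
    moreover have "V * 1 \<le> U * V" using U by simp
    ultimately have "K \<le> 2 * U * V" by linarith
    hence K2: "real K \<le> 2 * real U * real V" by (metis of_nat_le_iff of_nat_mult of_nat_numeral)
    obtain D where D: "D \<ge> 0" "D ^ (2 * Suc n) \<le> (M\<^sup>2 * real U * (2 * real K)) ^ (2 * n)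
          * (32 * real U * (2 * real K) * (M ^ 3 * (harm U)\<^sup>2 + M ^ 4 * (2 * real K)\<^sup>2 / q\<^sup>2))
          * (q * (real (Suc n) ^ Suc n * real V ^ Suc n * q + 2 * real (Suc n) * real V ^ (2 * Suc n)))"
        "Q \<le> A\<^sup>2 * (2 * M * real K + D / (real U * real V))"
      using interval_mean_square_shift[of \<M> \<alpha> A a n U V K K0] \<M>(1) \<alpha> a n(2) U Up V(1) Vp UV
      unfolding M_def q_def Q_def by blast
    have harm_U: "harm U \<ge> (1::real)" "harm U \<le> H"
      using harm_mono[of 1 U] harm_mono[of U p] U Up unfolding H_def
      by (simp_all add: harm_expand Suc_le_eq)
    have "(D / (real U * real V)) ^ (2 * Suc n)
        \<le> shift_const n * (harm U)\<^sup>2 * (M\<^sup>2 * real K) ^ (2 * Suc n) * (T * q / (M * (real K)\<^sup>2) + T / q)"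
      using D(1,2) M1 U V K1 q2 harm_U(1) Tq K2 by (intro shift_arithmetic) auto
    \<comment> \<open>Squaring the constant turns it and H^2 into the square of
      \<open>shift_const n * H\<close>, which is at least 1 and hence fits under the 2r-th
      power.\<close>
    also have "\<dots> \<le> (shift_const n * (shift_const n * 1 ^ (2 * n))) * H\<^sup>2 * (M\<^sup>2 * real K) ^ (2 * Suc n) * (2 * X)"
    proof (intro mult_mono)
      show "shift_const n \<le> shift_const n * (shift_const n * 1 ^ (2 * n))" using C1 by simp
      show "(harm U)\<^sup>2 \<le> H\<^sup>2" using harm_U by (intro power_mono) auto
      have sum_le: "x + y \<le> 2 * (u + v + z)" if "x \<le> z" "y \<le> z" "0 < u" "0 < v" "0 < z" for x y z u v :: real
        using that by argo
      have "T * q / (M * (real K)\<^sup>2) \<le> T * q / (w ^ 10 * (real K)\<^sup>2)"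
      proof (intro divide_left_mono mult_right_mono)
        show "w ^ 10 \<le> M" unfolding w13[symmetric] using w1 by (intro power_increasing) auto
      qed (use T1 q2 w1 K1 M1 in auto)
      moreover have "T / q \<le> T * q / (w ^ 10 * (real K)\<^sup>2)"
      proof -
        have "T * ((real K)\<^sup>2 * w ^ 10) \<le> T * q\<^sup>2" using False T1 by (intro mult_left_mono) auto
        thus ?thesis using q2 w1 K1 by (simp add: divide_simps power2_eq_square mult_ac)
      qed
      ultimately show "T * q / (M * (real K)\<^sup>2) + T / q \<le> 2 * X"
        using parts unfolding X by (intro sum_le)
    qed (use C1 M1 T1 q2 harm_U in auto)
    also have "\<dots> \<le> (4 * (shift_const n * H)) ^ (2 * Suc n) * (M\<^sup>2 * real K) ^ (2 * Suc n) * X"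
    proof -
      have "(2 * (shift_const n * H)\<^sup>2) \<le> (4 * (shift_const n * H))\<^sup>2" by (simp add: power_mult_distrib)
      also have "\<dots> \<le> (4 * (shift_const n * H)) ^ (2 * Suc n)"
        using CH by (intro power_increasing) auto
      finally have "(2 * (shift_const n * H)\<^sup>2) * ((M\<^sup>2 * real K) ^ (2 * Suc n) * X)
          \<le> (4 * (shift_const n * H)) ^ (2 * Suc n) * ((M\<^sup>2 * real K) ^ (2 * Suc n) * X)"
        using X0 by (intro mult_right_mono) auto
      thus ?thesis by (simp add: power_mult_distrib power2_eq_square mult_ac)
    qed
    also have "\<dots> = (M\<^sup>2 * real K * (4 * (shift_const n * H) * Y)) ^ (2 * Suc n)"
      unfolding YX[symmetric] by (simp only: power_mult_distrib[symmetric] mult_ac)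
    finally have "(D / (real U * real V)) ^ Suc (2 * n + 1) \<le> (M\<^sup>2 * real K * (4 * (shift_const n * H) * Y)) ^ Suc (2 * n + 1)"
      by simp
    hence "D / (real U * real V) \<le> M\<^sup>2 * real K * (4 * (shift_const n * H) * Y)"
      by (rule power_le_imp_le_base) (use CH Y0 in auto)
    thus ?thesis using D(3) by blast
  qed
  then obtain B where B: "Q \<le> A\<^sup>2 * (2 * M * real K + B)"
      "B \<le> M\<^sup>2 * real K * (4 * (shift_const n * H) * Y)" by blast
  have "2 * M * real K + B \<le> M\<^sup>2 * real K * (6 * shift_const n * H * Y)"
    using diag B(2) by (simp add: algebra_simps)
  hence "A\<^sup>2 * (2 * M * real K + B) \<le> A\<^sup>2 * (M\<^sup>2 * real K * (6 * shift_const n * H * Y))"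
    by (intro mult_left_mono) auto
  thus ?thesis using B(1) unfolding Q_def H_def Y_def by linarith
qed

section \<open>From the mean square over an interval to the bilinear form\<close>

lemma Fp_interval_units:
  assumes "S \<subseteq> Fp_units p" "Fp_interval p K S"
  obtains K0 where "S = (\<lambda>x. x mod int p) ` {K0 + 1..K0 + int K}" "K < p"
proof -
  obtain K0 where S: "S = (\<lambda>x. x mod int p) ` {K0 + 1..K0 + int K}"
    using assms(2) by (auto simp: Fp_interval_def)
  \<comment> \<open>Otherwise the interval would contain a multiple of \<open>p\<close>;
    \<open>z\<close> is the distance from its first point to the next such multiple.\<close>
  have "K < p"
  proof (rule ccontr)
    assume "\<not> K < p"
    define z where "z = (- (K0 + 1)) mod int p"
    define x where "x = K0 + 1 + z"
    have "0 \<le> z" "z < int p" by (simp_all add: z_def)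
    hence "x \<in> {K0 + 1..K0 + int K}" using \<open>\<not> K < p\<close> unfolding x_def by simp
    moreover have "x mod int p = 0" unfolding x_def z_def by (simp add: mod_add_right_eq)
    ultimately have "0 \<in> S" unfolding S by (metis image_eqI)
    thus False using assms(1) by (auto simp: Fp_units_def)
  qed
  thus ?thesis using that S by blast
qed

lemma bilinear_norm_square_le:
  fixes \<alpha> \<gamma> :: "int \<Rightarrow> complex" and \<M> :: "int set" and K0 :: int
  assumes \<gamma>: "\<And>k. k \<in> S \<Longrightarrow> cmod (\<gamma> k) \<le> \<Gamma>" and S: "S = (\<lambda>x. x mod int p) ` {K0 + 1..K0 + int K}"
    and units: "S \<subseteq> Fp_units p"
  shows "(cmod (\<Sum>m\<in>\<M>. \<Sum>k\<in>S. \<alpha> m * \<gamma> k * e_mod p (a * m * inv_p k)))\<^sup>2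
    \<le> real K * \<Gamma>\<^sup>2 * (\<Sum>k\<in>{K0 + 1..K0 + int K}. (cmod (\<Sum>m\<in>\<M>. \<alpha> m * inv_char (a * m) k))\<^sup>2)"
proof -
  define f where "f = (\<lambda>k. cmod (\<Sum>m\<in>\<M>. \<alpha> m * inv_char (a * m) k))"
  have fin: "finite S" by (simp add: S)
  have "(\<Sum>m\<in>\<M>. \<Sum>k\<in>S. \<alpha> m * \<gamma> k * e_mod p (a * m * inv_p k))
      = (\<Sum>k\<in>S. \<Sum>m\<in>\<M>. \<alpha> m * \<gamma> k * e_mod p (a * m * inv_p k))"
    by (rule sum.swap)
  also have "\<dots> = (\<Sum>k\<in>S. \<gamma> k * (\<Sum>m\<in>\<M>. \<alpha> m * inv_char (a * m) k))"
  proof (intro sum.cong refl)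
    fix k assume "k \<in> S"
    hence "\<not> int p dvd k" using units zdvd_not_zless[of k "int p"] by (force simp: Fp_units_def Fp_def)
    thus "(\<Sum>m\<in>\<M>. \<alpha> m * \<gamma> k * e_mod p (a * m * inv_p k)) = \<gamma> k * (\<Sum>m\<in>\<M>. \<alpha> m * inv_char (a * m) k)"
      by (simp add: inv_char_def sum_distrib_left mult_ac)
  qed
  also have "cmod \<dots> \<le> (\<Sum>k\<in>S. \<Gamma> * f k)"
    unfolding f_def by (intro sum_norm_le) (simp add: norm_mult mult_right_mono \<gamma>)
  finally have "(cmod (\<Sum>m\<in>\<M>. \<Sum>k\<in>S. \<alpha> m * \<gamma> k * e_mod p (a * m * inv_p k)))\<^sup>2 \<le> (\<Sum>k\<in>S. \<Gamma> * f k)\<^sup>2"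
    by (intro power_mono) auto
  also have "\<dots> = \<Gamma>\<^sup>2 * (\<Sum>k\<in>S. f k) ^ Suc 1"
    by (simp add: sum_distrib_left[symmetric] power_mult_distrib power2_eq_square)
  also have "\<dots> \<le> \<Gamma>\<^sup>2 * (real (card S) ^ 1 * (\<Sum>k\<in>S. f k ^ Suc 1))"
    by (intro mult_left_mono power_mean_card) (auto simp: f_def)
  also have "\<dots> \<le> \<Gamma>\<^sup>2 * (real K * (\<Sum>k\<in>{K0 + 1..K0 + int K}. (f k)\<^sup>2))"
  proof (intro mult_left_mono mult_mono)
    have "card S \<le> card {K0 + 1..K0 + int K}" unfolding S by (rule card_image_le) simp
    thus "real (card S) ^ 1 \<le> real K" by simp
    \<comment> \<open>Periodicity and non-negativity of \<open>f\<close> allow passing from the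
      residues in \<open>S\<close> to the integers \<open>K0 + 1, ..., K0 + K\<close>.\<close>
    have "f (k mod int p) = f k" for k
      unfolding f_def by (intro arg_cong[where f = cmod] sum.cong refl arg_cong2[of _ _ _ _ "(*)"] inv_char_cong) simp_all
    thus "(\<Sum>k\<in>S. f k ^ Suc 1) \<le> (\<Sum>k\<in>{K0 + 1..K0 + int K}. (f k)\<^sup>2)"
      unfolding S using sum_image_le[of "{K0 + 1..K0 + int K}" "\<lambda>k. (f k)\<^sup>2" "\<lambda>x. x mod int p"]
      by (simp add: comp_def power2_eq_square)
  qed (auto intro!: sum_nonneg simp: f_def)
  finally show ?thesis by (simp add: f_def mult_ac)
qed

end

theorem theorem2p6:
  fixes r :: nat
  assumes "r > 0"
  shows "\<forall>\<epsilon>::real. \<epsilon> > 0 \<longrightarrow>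
    (\<exists>(C::real) (p0::nat). C > 0 \<and>
      (\<forall>(p::nat) (\<M>::int set) (\<K>::int set) (M::nat) (K::nat) (a::int)
        (\<alpha>::int \<Rightarrow> complex) (\<gamma>::int \<Rightarrow> complex).
        prime p \<longrightarrow> p \<ge> p0 \<longrightarrow>
        \<M> \<subseteq> Fp p \<longrightarrow> card \<M> = M \<longrightarrow> 1 \<le> M \<longrightarrow> real M \<le> real p powr (1 / 2) \<longrightarrow>
        \<K> \<subseteq> Fp_units p \<longrightarrow> Fp_interval p K \<K> \<longrightarrow> real K \<ge> real p powr (1 / real r) \<longrightarrow>
        a \<in> Fp_units p \<longrightarrow>
        cmod (\<Sum>m\<in>\<M>. \<Sum>k\<in>\<K>. \<alpha> m * \<gamma> k * e_mod p (a * m * modular_inverse (int p) k))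
          \<le> C * weight_norm \<M> \<alpha> * weight_norm \<K> \<gamma> * real M * real K * real p powr \<epsilon> *
            (1 / real M ^ (2 * r) + 1 / real K
              + real p powr (1 + 1 / real r) / (real M powr (10 / 13) * real K ^ 2))
              powr (1 / (4 * real r))))"
proof (intro allI impI)
  fix \<epsilon> :: real assume \<epsilon>: "\<epsilon> > 0"
  define n where "n = r - 1"
  have r: "r = Suc n" using assms by (simp add: n_def)
  define c where "c = 6 * shift_const n * (1 + 1 / (2 * \<epsilon>))"
  have c: "c > 0" using \<epsilon> shift_const_ge_1[of n] by (auto simp: c_def intro!: mult_pos_pos add_pos_pos)
  show "\<exists>(C::real) (p0::nat). C > 0 \<and>
      (\<forall>(p::nat) (\<M>::int set) (\<K>::int set) (M::nat) (K::nat) (a::int)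
        (\<alpha>::int \<Rightarrow> complex) (\<gamma>::int \<Rightarrow> complex).
        prime p \<longrightarrow> p \<ge> p0 \<longrightarrow>
        \<M> \<subseteq> Fp p \<longrightarrow> card \<M> = M \<longrightarrow> 1 \<le> M \<longrightarrow> real M \<le> real p powr (1 / 2) \<longrightarrow>
        \<K> \<subseteq> Fp_units p \<longrightarrow> Fp_interval p K \<K> \<longrightarrow> real K \<ge> real p powr (1 / real r) \<longrightarrow>
        a \<in> Fp_units p \<longrightarrow>
        cmod (\<Sum>m\<in>\<M>. \<Sum>k\<in>\<K>. \<alpha> m * \<gamma> k * e_mod p (a * m * modular_inverse (int p) k))
          \<le> C * weight_norm \<M> \<alpha> * weight_norm \<K> \<gamma> * real M * real K * real p powr \<epsilon> *
            (1 / real M ^ (2 * r) + 1 / real K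
              + real p powr (1 + 1 / real r) / (real M powr (10 / 13) * real K ^ 2))
              powr (1 / (4 * real r)))"
  \<comment> \<open>The estimate is proved for the square of the sum, whence \<open>sqrt c\<close>;
    p >= r + 1 is what the moment bound requires of \<open>p\<close>.\<close>
  proof (intro exI[of _ "sqrt c"] exI[of _ "Suc r"] conjI allI impI)
    show "sqrt c > 0" using c by simp
  next
    fix p M K :: nat and \<M> \<K> :: "int set" and a :: int and \<alpha> \<gamma> :: "int \<Rightarrow> complex"
    assume p: "prime p" "p \<ge> Suc r" and \<M>: "\<M> \<subseteq> Fp p" "card \<M> = M" "1 \<le> M" "real M \<le> real p powr (1 / 2)"
      and \<K>: "\<K> \<subseteq> Fp_units p" "Fp_interval p K \<K>" "real K \<ge> real p powr (1 / real r)"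
      and a: "a \<in> Fp_units p"
    interpret prime_modulus p by unfold_locales (rule p(1))
    define A \<Gamma> where "A = weight_norm \<M> \<alpha>" and "\<Gamma> = weight_norm \<K> \<gamma>"
    define T where "T = real p powr (1 / real r)"
    define X where "X = 1 / real M ^ (2 * r) + 1 / real K
        + real p powr (1 + 1 / real r) / (real M powr (10 / 13) * real K ^ 2)"
    define P where "P = A * \<Gamma> * real M * real K"
    obtain K0 where K0: "\<K> = (\<lambda>x. x mod int p) ` {K0 + 1..K0 + int K}" and Kp: "K < p"
      using \<K>(1,2) by (rule Fp_interval_units)
    have p1: "real p \<ge> 1" using prime_ge_1_nat[OF p(1)] by simp
    have T1: "T \<ge> 1" unfolding T_def using p1 by (intro ge_one_powr_ge_zero) auto
    have K1: "K \<ge> 1" using \<K>(3) T1 unfolding T_def by linarith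
    have fin: "finite \<M>" "\<M> \<noteq> {}" "finite \<K>" "\<K> \<noteq> {}"
      using \<M> K1 by (auto simp: K0 intro: card_ge_0_finite)
    have A: "cmod (\<alpha> m) \<le> A" if "m \<in> \<M>" for m
      using that fin unfolding A_def weight_norm_def by (intro Max_ge) auto
    have \<Gamma>: "cmod (\<gamma> k) \<le> \<Gamma>" if "k \<in> \<K>" for k
      using that fin unfolding \<Gamma>_def weight_norm_def by (intro Max_ge) auto
    have "A \<ge> 0" "\<Gamma> \<ge> 0" using A \<Gamma> fin norm_ge_zero order.trans by (metis ex_in_conv)+
    hence P0: "P \<ge> 0" by (simp add: P_def)
    \<comment> \<open>For r = 1 the hypothesis on \<open>K\<close> reads K >= p, which an interval
      of units cannot satisfy.\<close>
    have n: "1 \<le> n"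
    proof (rule ccontr)
      assume "\<not> 1 \<le> n"
      hence "n = 0" by simp
      hence "real K \<ge> real p" using \<K>(3) p1 by (simp add: r)
      thus False using Kp by simp
    qed
    have a': "\<not> int p dvd a" using a zdvd_not_zless[of a "int p"] by (auto simp: Fp_units_def Fp_def)
    have X_eq: "X = 1 / real (card \<M>) ^ (2 * Suc n) + 1 / real K
        + real p powr (1 / real (Suc n)) * real p / (real (card \<M>) powr (10 / 13) * (real K)\<^sup>2)"
      using p1 by (simp add: X_def r \<M>(2) powr_add mult.commute)
    have "X > 0" unfolding X_def using \<M>(3) K1 by (intro add_pos_nonneg) auto
    hence Y2: "(X powr (1 / (4 * real r)))\<^sup>2 = X powr (1 / (2 * real r))"
      using assms by (simp add: powr_powr flip: powr_realpow)
    have Q: "(\<Sum>k\<in>{K0 + 1..K0 + int K}. (cmod (\<Sum>m\<in>\<M>. \<alpha> m * inv_char (a * m) k))\<^sup>2)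
        \<le> A\<^sup>2 * ((real M)\<^sup>2 * real K * (6 * shift_const n * harm p * X powr (1 / (2 * real r))))"
      using interval_mean_square[of \<M> \<alpha> A a n K K0] \<M>(1,2,4) fin(2) A a' n p(2) \<K>(3) Kp
      unfolding X_eq[symmetric] by (simp add: r)
    have "(cmod (\<Sum>m\<in>\<M>. \<Sum>k\<in>\<K>. \<alpha> m * \<gamma> k * e_mod p (a * m * inv_p k)))\<^sup>2
        \<le> real K * \<Gamma>\<^sup>2 * (A\<^sup>2 * ((real M)\<^sup>2 * real K * (6 * shift_const n * harm p * X powr (1 / (2 * real r)))))"
      by (rule order.trans[OF bilinear_norm_square_le[OF _ K0 \<K>(1)]], erule \<Gamma>)
         (intro mult_left_mono Q, auto)
    also have "\<dots> = (P\<^sup>2 * X powr (1 / (2 * real r)) * (6 * shift_const n)) * harm p"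
      by (simp add: P_def power_mult_distrib power2_eq_square mult_ac)
    \<comment> \<open>The harmonic number is bounded with exponent 2 \<epsilon>, which the final
      square root halves.\<close>
    also have "\<dots> \<le> (P\<^sup>2 * X powr (1 / (2 * real r)) * (6 * shift_const n))
        * ((1 + 1 / (2 * \<epsilon>)) * real p powr (2 * \<epsilon>))"
      using \<epsilon> shift_const_ge_1[of n] by (intro mult_left_mono harm_le_powr) auto
    also have "\<dots> = (sqrt c * P * real p powr \<epsilon> * X powr (1 / (4 * real r)))\<^sup>2"
    proof -
      have "(real p powr \<epsilon>)\<^sup>2 = real p powr (2 * \<epsilon>)" by (simp add: power2_eq_square flip: powr_add)
      moreover have "(sqrt c)\<^sup>2 = c" using c by simp
      ultimately show ?thesis by (simp only: power_mult_distrib Y2) (simp only: c_def mult_ac)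
    qed
    finally have "cmod (\<Sum>m\<in>\<M>. \<Sum>k\<in>\<K>. \<alpha> m * \<gamma> k * e_mod p (a * m * inv_p k))
        \<le> sqrt c * P * real p powr \<epsilon> * X powr (1 / (4 * real r))"
      by (rule power2_le_imp_le) (use c P0 in auto)
    thus "cmod (\<Sum>m\<in>\<M>. \<Sum>k\<in>\<K>. \<alpha> m * \<gamma> k * e_mod p (a * m * modular_inverse (int p) k))
          \<le> sqrt c * weight_norm \<M> \<alpha> * weight_norm \<K> \<gamma> * real M * real K * real p powr \<epsilon> *
            (1 / real M ^ (2 * r) + 1 / real K
              + real p powr (1 + 1 / real r) / (real M powr (10 / 13) * real K ^ 2))
              powr (1 / (4 * real r))"
      unfolding P_def X_def A_def \<Gamma>_def by (simp only: mult.assoc)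
  qed
qed

end
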